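(* Let $(a_{nk})_{n,k=0}^\infty$ be an infinite complex matrix satisfying the following conditions. (E1) There exist $(d_n)_{n\in\mathbb{N}_0}\subset(0,\infty)$ and $(b_{nk})_{n,k\in\mathbb{N}_0},(c_{nk})_{n,k\in\mathbb{N}_0}\subset\mathbb{C}$ such that $a_{nk}=-\delta_{nk}d_n+b_{nk}+c_{nk}$ for $n,k\in\mathbb{N}_0$, where $\delta_{nk}$ is the Kronecker delta. (E2) There exist $\alpha_*\in\mathbb{R}$ and, for all $\alpha>\alpha_*$, a constant $q(\alpha)\in(0,1)$ with $e^{-\alpha k}\sum_{n=0}^\infty|b_{nk}|e^{\alpha n}\le q(\alpha)d_k$ for all $k\in\mathbb{N}_0$, $\alpha>\alpha_*$. (E3) $\sup_{n\in\mathbb{N}}d_ne^{-\nu n}<\infty$ for all $\nu>0$. (E4) There exists a continuous increasing function $M:(\alpha_*,\infty)\to(0,\infty)$ such that $e^{-\alpha k}\sum_{n=0}^\infty|c_{nk}|e^{\alpha'n}\le\frac{M(\alpha)}{\alpha-\alpha'}$ for all $k\in\mathbb{N}_0$ and $\alpha_*<\alpha'<\alpha$. For each $N\ge1$ define $a^N_{nk}=-\delta_{nk}d^N_n+b^N_{nk}+c^N_{nk}$ by setting $$d^N_n=\mathbf{1}_{\{n\le N\}}d_n,\qquad b^N_{nk}=\mathbf{1}_{\{n,k\le N\}}b_{nk},\qquad c^N_{nk}=\mathbf{1}_{\{n,k\le N\}}c_{nk}.$$ Then, for all $\alpha_*<\alpha'<\alpha$ and $x=(x_n)_{n=0}^\infty\in\mathbb{E}_\alpha$,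 with $T(\alpha',\alpha)=\frac{\alpha-\alpha'}{2eM(\alpha)}$, there exists a unique classical solution $(u(t))_{0\le t<T(\alpha',\alpha)}\subset\mathbb{E}_{\alpha'}$ to $$\frac{du_n(t)}{dt}=\sum_{k=0}^\infty a_{nk}u_k(t),\qquad u_n(0)=x_n,\qquad n\in\mathbb{N}_0,$$ and for all $N\ge1$ there exist unique classical solutions $(u^N(t))_{0\le t<T(\alpha',\alpha)}\subset\mathbb{E}_{\alpha'}$ to $$\frac{du^N_n(t)}{dt}=\sum_{k=0}^\infty a^N_{nk}u^N_k(t),\qquad u^N_n(0)=x_n,\qquad n\in\mathbb{N}_0.$$ Moreover, $$\lim_{N\to\infty}\sup_{t\in[0,T]}\sum_{n=0}^\infty|u^N_n(t)-u_n(t)|e^{\alpha'n}=0,\qquad T\in(0,T(\alpha',\alpha)).$$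
   Context: For $\alpha\in\mathbb{R}$, $\mathbb{E}_\alpha$ is the Banach space of complex sequences $u=(u_n)_{n=0}^\infty$ with $\|u\|_\alpha:=\sum_{n=0}^\infty|u_n|e^{\alpha n}<\infty$; $\mathbb{E}_\alpha\subset\mathbb{E}_{\alpha'}$ for $\alpha'<\alpha$, with embedding denoted $i_{\alpha\alpha'}$. Under (E1)–(E4) the maps $(Gu)_n:=\sum_ka_{nk}u_k$ and $(G^Nu)_n:=\sum_ka^N_{nk}u_k$ are (with absolutely convergent sums) bounded linear operators from $\mathbb{E}_\beta$ to $\mathbb{E}_{\beta'}$ for all $\alpha_*<\beta'<\beta$. Classical solution in $\mathbb{E}_{\alpha'}$ on an interval $I=[0,T)$ to the system with operator $H\in\{G,G^N\}$ and initial value $x\in\mathbb{E}_\alpha$ ($\alpha_*<\alpha'<\alpha$): a function $u\in C(I;\mathbb{E}_{\alpha'})$ with $u(0)=x$ such that, for all $\alpha''\in(\alpha_*,\alpha')$, $i_{\alpha'\alpha''}u\in C^1(I;\mathbb{E}_{\alpha''})$ and $\frac{d}{dt}i_{\alpha'\alpha''}u(t)=Hu(t)$ in $\mathbb{E}_{\alpha''}$ for $t\in I$. *)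

theory Defs
  imports "HOL-Analysis.Analysis"
begin

definition seq_norm :: "real \<Rightarrow> (nat \<Rightarrow> complex) \<Rightarrow> real" where
  "seq_norm \<alpha> u = (\<Sum>n. cmod (u n) * exp (\<alpha> * real n))"

definition seq_space :: "real \<Rightarrow> (nat \<Rightarrow> complex) set" where
  "seq_space \<alpha> = {u. summable (\<lambda>n. cmod (u n) * exp (\<alpha> * real n))}"

(* The spaces depend on a real parameter, so they are carrier sets rather than types; the
   embeddings between them are identities. Continuity and differentiability are with respect
   to the norm of the chosen space, one-sided at an endpoint belonging to I. *)

definition seq_continuous_on :: "real \<Rightarrow> real set \<Rightarrow> (real \<Rightarrow> nat \<Rightarrow> complex) \<Rightarrow> bool" where
  "seq_continuous_on \<alpha> I u \<longleftrightarrow>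
     (\<forall>t\<in>I. u t \<in> seq_space \<alpha> \<and>
        ((\<lambda>s. seq_norm \<alpha> (\<lambda>n. u s n - u t n)) \<longlongrightarrow> 0) (at t within I))"

definition seq_has_derivative ::
  "real \<Rightarrow> real set \<Rightarrow> (real \<Rightarrow> nat \<Rightarrow> complex) \<Rightarrow> (nat \<Rightarrow> complex) \<Rightarrow> real \<Rightarrow> bool" where
  "seq_has_derivative \<alpha> I u v t \<longleftrightarrow>
     (\<forall>s\<in>I. u s \<in> seq_space \<alpha>) \<and> v \<in> seq_space \<alpha> \<and>
     ((\<lambda>s. seq_norm \<alpha> (\<lambda>n. (u s n - u t n) / of_real (s - t) - v n)) \<longlongrightarrow> 0) (at t within I)"

definition seq_C1_on :: "real \<Rightarrow> real set \<Rightarrow> (real \<Rightarrow> nat \<Rightarrow> complex) \<Rightarrow> bool" where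
  "seq_C1_on \<alpha> I u \<longleftrightarrow>
     (\<exists>u'. seq_continuous_on \<alpha> I u' \<and> (\<forall>t\<in>I. seq_has_derivative \<alpha> I u (u' t) t))"

definition mat_op :: "(nat \<Rightarrow> nat \<Rightarrow> complex) \<Rightarrow> (nat \<Rightarrow> complex) \<Rightarrow> nat \<Rightarrow> complex" where
  "mat_op A u n = (\<Sum>k. A n k * u k)"

definition classical_solution ::
  "real \<Rightarrow> real \<Rightarrow> real set \<Rightarrow> (nat \<Rightarrow> nat \<Rightarrow> complex) \<Rightarrow> (nat \<Rightarrow> complex) \<Rightarrow>
   (real \<Rightarrow> nat \<Rightarrow> complex) \<Rightarrow> bool" where
  "classical_solution \<alpha>\<^sub>0 \<alpha>' I A x u \<longleftrightarrow>
     seq_continuous_on \<alpha>' I u \<and> u 0 = x \<and>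
     (\<forall>\<alpha>''. \<alpha>\<^sub>0 < \<alpha>'' \<and> \<alpha>'' < \<alpha>' \<longrightarrow>
        seq_C1_on \<alpha>'' I u \<and> (\<forall>t\<in>I. seq_has_derivative \<alpha>'' I u (mat_op A (u t)) t))"

definition generator_mat ::
  "(nat \<Rightarrow> real) \<Rightarrow> (nat \<Rightarrow> nat \<Rightarrow> complex) \<Rightarrow> (nat \<Rightarrow> nat \<Rightarrow> complex) \<Rightarrow> nat \<Rightarrow> nat \<Rightarrow> complex" where
  "generator_mat d b c n k = - (of_bool (n = k) * of_real (d n)) + b n k + c n k"

definition trunc_vec :: "nat \<Rightarrow> (nat \<Rightarrow> real) \<Rightarrow> nat \<Rightarrow> real" where
  "trunc_vec N d n = of_bool (n \<le> N) * d n"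

definition trunc_mat :: "nat \<Rightarrow> (nat \<Rightarrow> nat \<Rightarrow> complex) \<Rightarrow> nat \<Rightarrow> nat \<Rightarrow> complex" where
  "trunc_mat N b n k = of_bool (n \<le> N \<and> k \<le> N) * b n k"

definition existence_time :: "(real \<Rightarrow> real) \<Rightarrow> real \<Rightarrow> real \<Rightarrow> real" where
  "existence_time M \<alpha>' \<alpha> = (\<alpha> - \<alpha>') / (2 * exp 1 * M \<alpha>)"

end

theory Submission
  imports Defs
begin

text \<open>The operator \<open>C = (c\<^sub>n\<^sub>k)\<close> may be unbounded in every space of the scale, but in weighted
  \<open>\<ell>\<^sup>1\<close> the condition (E4) says more than an Ovsyannikov estimate. An operator norm is a supremum
  of column sums, so (E4) may be applied to each column with its own larger exponent
  \<open>\<gamma> + 1/k\<close>; this gives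
  \<open>\<Sum>n. |c\<^sub>n\<^sub>k| e\<^sup>\<gamma>\<^sup>n \<le> (E + v k) e\<^sup>\<gamma>\<^sup>k\<close> with \<open>v = 2 e M(\<alpha>)\<close>, uniformly for
  \<open>\<gamma> \<le> \<alpha>\<close> (\<open>linear_column_bound\<close>). The factor 2 pays for replacing \<open>M(\<alpha> + 1/k)\<close> by
  \<open>M(\<alpha>)\<close>. In other words \<open>C\<close> is dominated by \<open>v\<close> times the generator \<open>k\<close> of the
  change of weight. If the exponent is lowered at speed \<open>v\<close>, the decrease of the weight
  \<open>e\<^sup>(\<^sup>\<beta>\<^sup>-\<^sup>v\<^sup>t\<^sup>)\<^sup>k\<close> compensates \<open>C\<close>, while the diagonal \<open>-d\<^sub>k\<close> compensates
  \<open>B = (b\<^sub>n\<^sub>k)\<close> by (E2). Hence every solution of \<open>w' = A w + f\<close>, where \<open>A = (a\<^sub>n\<^sub>k)\<close>, satisfies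
  \<open>\<parallel>w(t)\<parallel>\<^sub>\<beta>\<^sub>-\<^sub>v\<^sub>t \<le> e\<^sup>E\<^sup>t (\<parallel>w(0)\<parallel>\<^sub>\<beta> + \<delta> t)\<close> whenever
  \<open>\<parallel>f(t)\<parallel>\<^sub>\<beta>\<^sub>-\<^sub>v\<^sub>t \<le> \<delta>\<close> (\<open>moving_weight_estimate\<close>). Starting from \<open>\<alpha>\<close>, the exponent
  stays above \<open>\<alpha>'\<close> exactly up to the time \<open>(\<alpha> - \<alpha>')/v = T(\<alpha>',\<alpha>)\<close>.

  Everything follows from this one estimate, which is obtained from the norm of an explicit Euler
  step (\<open>Euler_step\<close>) and an inequality for functions with bounded right difference quotients (\<open>right_increment_bound\<close>).

  Uniqueness is the case \<open>f = 0\<close>, \<open>w(0) = 0\<close>, applied on short intervals one after the other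
  (\<open>classical_solution_unique\<close>). The truncated systems satisfy the same hypotheses with the same
  constants (\<open>trunc_drift_dominated\<close>), and they are solved by power series
  (\<open>truncated_flow_exists\<close>). The difference \<open>w = u\<^sup>N - u\<^sup>K\<close> of two truncated solutions solves
  the equation with \<open>f = (G\<^sup>N - G\<^sup>K) u\<^sup>K\<close>. Only matrix entries with an index
  above \<open>min N K\<close> contribute to this force, so a small loss in the exponent makes it of the order of \<open>e\<^sup>-\<^sup>\<epsilon>\<^sup>m\<^sup>i\<^sup>n\<^sup>(\<^sup>N\<^sup>,\<^sup>K\<^sup>)\<close>
  (\<open>tail_columns\<close>, \<open>truncated_flows_Cauchy\<close>). The \<open>u\<^sup>N\<close> therefore converge uniformly on
  compact time intervals at an exponential rate, and the limit is a classical solution of the full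
  system (\<open>truncation_limit_classical_solution\<close>).\<close>

section \<open>Weighted sequence spaces\<close>

lemma seq_norm_nonneg: "u \<in> seq_space \<alpha> \<Longrightarrow> 0 \<le> seq_norm \<alpha> u"
  unfolding seq_norm_def seq_space_def by (auto intro: suminf_nonneg)

lemma seq_space_bounded:
  assumes "\<And>m. (\<Sum>n<m. cmod (u n) * exp (\<alpha> * real n)) \<le> K"
  shows "u \<in> seq_space \<alpha>" and "seq_norm \<alpha> u \<le> K"
proof -
  have "summable (\<lambda>n. cmod (u n) * exp (\<alpha> * real n))"
    by (rule summableI_nonneg_bounded[of _ K]) (use assms in auto)
  then show "u \<in> seq_space \<alpha>" and "seq_norm \<alpha> u \<le> K"
    unfolding seq_norm_def seq_space_def using assms by (auto intro: suminf_le_const)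
qed

lemma partial_sum_le_seq_norm:
  assumes "u \<in> seq_space \<alpha>"
  shows "(\<Sum>n<m. cmod (u n) * exp (\<alpha> * real n)) \<le> seq_norm \<alpha> u"
  unfolding seq_norm_def by (rule sum_le_suminf) (use assms in \<open>auto simp: seq_space_def\<close>)

lemma cmod_le_seq_norm:
  assumes "u \<in> seq_space \<alpha>"
  shows "cmod (u n) * exp (\<alpha> * real n) \<le> seq_norm \<alpha> u"
proof -
  have "cmod (u n) * exp (\<alpha> * real n) \<le> (\<Sum>n<Suc n. cmod (u n) * exp (\<alpha> * real n))"
    by (simp add: sum_nonneg)
  also have "\<dots> \<le> seq_norm \<alpha> u"
    by (rule partial_sum_le_seq_norm[OF assms])
  finally show ?thesis .
qed

lemma seq_norm_eq_0D:
  assumes "u \<in> seq_space \<alpha>" "seq_norm \<alpha> u \<le> 0"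
  shows "u = (\<lambda>n. 0)"
proof
  fix n
  have "cmod (u n) * exp (\<alpha> * real n) \<le> 0"
    using cmod_le_seq_norm[OF assms(1), of n] assms(2) by linarith
  then show "u n = 0" by (simp add: mult_le_0_iff not_le[symmetric])
qed

lemma seq_space_zero [simp]: "(\<lambda>n. 0) \<in> seq_space \<alpha>"
  by (simp add: seq_space_def)

lemma seq_norm_zero [simp]: "seq_norm \<alpha> (\<lambda>n. 0) = 0"
  by (simp add: seq_norm_def)

lemma seq_dominated:
  assumes "v \<in> seq_space \<beta>" "\<And>n. cmod (u n) * exp (\<alpha> * real n) \<le> cmod (v n) * exp (\<beta> * real n)"
  shows "u \<in> seq_space \<alpha>" and "seq_norm \<alpha> u \<le> seq_norm \<beta> v"
proof -
  have "(\<Sum>n<m. cmod (u n) * exp (\<alpha> * real n)) \<le> seq_norm \<beta> v" for m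
  proof -
    have "(\<Sum>n<m. cmod (u n) * exp (\<alpha> * real n)) \<le> (\<Sum>n<m. cmod (v n) * exp (\<beta> * real n))"
      by (rule sum_mono) (rule assms)
    also have "\<dots> \<le> seq_norm \<beta> v"
      by (rule partial_sum_le_seq_norm[OF assms(1)])
    finally show ?thesis .
  qed
  from seq_space_bounded[OF this] show "u \<in> seq_space \<alpha>" and "seq_norm \<alpha> u \<le> seq_norm \<beta> v" .
qed

lemma seq_space_mono:
  assumes "u \<in> seq_space \<beta>" "\<alpha> \<le> \<beta>"
  shows "u \<in> seq_space \<alpha>" and "seq_norm \<alpha> u \<le> seq_norm \<beta> u"
  using seq_dominated[OF assms(1), of u \<alpha>] assms(2) by (auto simp: mult_left_mono mult_right_mono)

lemma seq_triangle:
  assumes "u \<in> seq_space \<alpha>" "v \<in> seq_space \<alpha>" "\<And>n. cmod (w n) \<le> cmod (u n) + cmod (v n)"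
  shows "w \<in> seq_space \<alpha>" and "seq_norm \<alpha> w \<le> seq_norm \<alpha> u + seq_norm \<alpha> v"
proof -
  have "(\<Sum>n<m. cmod (w n) * exp (\<alpha> * real n)) \<le> seq_norm \<alpha> u + seq_norm \<alpha> v" for m
  proof -
    have "(\<Sum>n<m. cmod (w n) * exp (\<alpha> * real n)) \<le>
        (\<Sum>n<m. cmod (u n) * exp (\<alpha> * real n) + cmod (v n) * exp (\<alpha> * real n))"
      by (rule sum_mono) (use assms(3) in \<open>simp flip: distrib_right\<close>)
    also have "\<dots> = (\<Sum>n<m. cmod (u n) * exp (\<alpha> * real n)) + (\<Sum>n<m. cmod (v n) * exp (\<alpha> * real n))"
      by (rule sum.distrib)
    also have "\<dots> \<le> seq_norm \<alpha> u + seq_norm \<alpha> v"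
      by (intro add_mono partial_sum_le_seq_norm assms)
    finally show ?thesis .
  qed
  from seq_space_bounded[OF this]
  show "w \<in> seq_space \<alpha>" and "seq_norm \<alpha> w \<le> seq_norm \<alpha> u + seq_norm \<alpha> v" .
qed

lemma seq_add:
  assumes "u \<in> seq_space \<alpha>" "v \<in> seq_space \<alpha>"
  shows "(\<lambda>n. u n + v n) \<in> seq_space \<alpha>"
    and "seq_norm \<alpha> (\<lambda>n. u n + v n) \<le> seq_norm \<alpha> u + seq_norm \<alpha> v"
  using seq_triangle[OF assms, of "\<lambda>n. u n + v n"] by (auto simp: norm_triangle_ineq)

lemma seq_diff:
  assumes "u \<in> seq_space \<alpha>" "v \<in> seq_space \<alpha>"
  shows "(\<lambda>n. u n - v n) \<in> seq_space \<alpha>"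
    and "seq_norm \<alpha> (\<lambda>n. u n - v n) \<le> seq_norm \<alpha> u + seq_norm \<alpha> v"
  using seq_triangle[OF assms, of "\<lambda>n. u n - v n"] by (auto simp: norm_triangle_ineq4)

lemma seq_scale:
  assumes "u \<in> seq_space \<alpha>"
  shows "(\<lambda>n. z * u n) \<in> seq_space \<alpha>"
    and "seq_norm \<alpha> (\<lambda>n. z * u n) = cmod z * seq_norm \<alpha> u"
  using assms by (auto simp: seq_space_def seq_norm_def norm_mult mult.assoc summable_mult suminf_mult)

text \<open>The unit balls of the spaces are closed under componentwise convergence (Fatou's lemma for
  series), because every partial sum of the norm is a continuous function of finitely many
  components.\<close>

lemma seq_norm_Fatou:
  assumes lim: "\<And>n. (\<lambda>N. u N n) \<longlonglongrightarrow> v n"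
    and bd: "\<forall>\<^sub>F N in sequentially. u N \<in> seq_space \<alpha> \<and> seq_norm \<alpha> (u N) \<le> K N"
    and K: "K \<longlonglongrightarrow> L"
  shows "v \<in> seq_space \<alpha>" and "seq_norm \<alpha> v \<le> L"
proof -
  have "(\<Sum>n<m. cmod (v n) * exp (\<alpha> * real n)) \<le> L" for m
  proof (rule tendsto_le[OF _ K])
    show "(\<lambda>N. \<Sum>n<m. cmod (u N n) * exp (\<alpha> * real n)) \<longlonglongrightarrow> (\<Sum>n<m. cmod (v n) * exp (\<alpha> * real n))"
      by (intro tendsto_intros lim)
    show "\<forall>\<^sub>F N in sequentially. (\<Sum>n<m. cmod (u N n) * exp (\<alpha> * real n)) \<le> K N"
      using bd by eventually_elim (auto intro: order_trans[OF partial_sum_le_seq_norm])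
  qed simp
  from seq_space_bounded[OF this] show "v \<in> seq_space \<alpha>" and "seq_norm \<alpha> v \<le> L" .
qed

section \<open>Matrices with bounded columns\<close>

text \<open>The number \<open>m k\<close> bounds the norm in the space with exponent \<open>\<gamma>\<close> of the image of the
  \<open>k\<close>-th unit vector.\<close>

definition column_bounded ::
  "real \<Rightarrow> (nat \<Rightarrow> nat \<Rightarrow> complex) \<Rightarrow> (nat \<Rightarrow> real) \<Rightarrow> bool" where
  "column_bounded \<gamma> A m \<longleftrightarrow>
     (\<forall>k. summable (\<lambda>n. cmod (A n k) * exp (\<gamma> * real n)) \<and>
          (\<Sum>n. cmod (A n k) * exp (\<gamma> * real n)) \<le> m k)"

lemma column_bounded_iff:
  "column_bounded \<gamma> A m \<longleftrightarrow> (\<forall>k. (\<lambda>n. A n k) \<in> seq_space \<gamma> \<and> seq_norm \<gamma> (\<lambda>n. A n k) \<le> m k)"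
  by (simp add: column_bounded_def seq_space_def seq_norm_def)

lemma column_bounded_mono:
  assumes "column_bounded \<gamma> A m" "\<And>n k. cmod (B n k) \<le> cmod (A n k)" "\<And>k. m k \<le> m' k"
  shows "column_bounded \<gamma> B m'"
  unfolding column_bounded_iff
proof
  fix k
  have *: "(\<lambda>n. A n k) \<in> seq_space \<gamma>" "seq_norm \<gamma> (\<lambda>n. A n k) \<le> m k"
    using assms(1) by (auto simp: column_bounded_iff)
  have le: "cmod (B n k) * exp (\<gamma> * real n) \<le> cmod (A n k) * exp (\<gamma> * real n)" for n
    using assms(2) by simp
  show "(\<lambda>n. B n k) \<in> seq_space \<gamma> \<and> seq_norm \<gamma> (\<lambda>n. B n k) \<le> m' k"
    using seq_dominated[OF *(1) le] *(2) assms(3)[of k] by linarith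
qed

lemma column_bounded_add:
  assumes "column_bounded \<gamma> A m" "column_bounded \<gamma> B m'"
  shows "column_bounded \<gamma> (\<lambda>n k. A n k + B n k) (\<lambda>k. m k + m' k)"
  unfolding column_bounded_iff
proof
  fix k
  have "(\<lambda>n. A n k) \<in> seq_space \<gamma>" "seq_norm \<gamma> (\<lambda>n. A n k) \<le> m k"
    "(\<lambda>n. B n k) \<in> seq_space \<gamma>" "seq_norm \<gamma> (\<lambda>n. B n k) \<le> m' k"
    using assms by (auto simp: column_bounded_iff)
  then show "(\<lambda>n. A n k + B n k) \<in> seq_space \<gamma> \<and> seq_norm \<gamma> (\<lambda>n. A n k + B n k) \<le> m k + m' k"
    using seq_add[of "\<lambda>n. A n k" \<gamma> "\<lambda>n. B n k"] by linarith
qed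

lemma column_bounded_scale:
  assumes "column_bounded \<gamma> A m"
  shows "column_bounded \<gamma> (\<lambda>n k. z * A n k) (\<lambda>k. cmod z * m k)"
  using assms unfolding column_bounded_iff by (simp add: seq_scale mult_left_mono)

lemma column_bounded_diag:
  assumes "\<And>k. cmod (z k) \<le> m k"
  shows "column_bounded \<gamma> (\<lambda>n k. of_bool (n = k) * z k) (\<lambda>k. m k * exp (\<gamma> * real k))"
  unfolding column_bounded_def
proof (intro allI)
  fix k
  have "(\<lambda>n. cmod (of_bool (n = k) * z k) * exp (\<gamma> * real n)) =
        (\<lambda>n. if n = k then cmod (z n) * exp (\<gamma> * real n) else 0)"
    by auto
  moreover have "(\<lambda>n. if n = k then cmod (z n) * exp (\<gamma> * real n) else 0) sums (cmod (z k) * exp (\<gamma> * real k))"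
    by (rule sums_single)
  ultimately have "(\<lambda>n. cmod (of_bool (n = k) * z k) * exp (\<gamma> * real n)) sums (cmod (z k) * exp (\<gamma> * real k))"
    by simp
  then show "summable (\<lambda>n. cmod (of_bool (n = k) * z k) * exp (\<gamma> * real n)) \<and>
      (\<Sum>n. cmod (of_bool (n = k) * z k) * exp (\<gamma> * real n)) \<le> m k * exp (\<gamma> * real k)"
    using assms by (auto simp: sums_iff)
qed

lemma column_bounded_entry:
  assumes "column_bounded \<gamma> A m"
  shows "cmod (A n k) * exp (\<gamma> * real n) \<le> m k"
  using cmod_le_seq_norm[of "\<lambda>n. A n k" \<gamma> n] assms
  by (auto simp: column_bounded_iff intro: order_trans)

text \<open>On weighted \<open>\<ell>\<^sup>1\<close> spaces the norm of an operator is the supremum of its column sums; this is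
  why column bounds are all that is needed to control a matrix.\<close>

lemma column_bounded_mat_op:
  assumes A: "column_bounded \<gamma> A m" and m: "summable (\<lambda>k. m k * cmod (u k))"
  shows "summable (\<lambda>k. A n k * u k)"
    and "mat_op A u \<in> seq_space \<gamma>"
    and "seq_norm \<gamma> (mat_op A u) \<le> (\<Sum>k. m k * cmod (u k))"
proof -
  have entry: "cmod (A n k * u k) * exp (\<gamma> * real n) \<le> m k * cmod (u k)" for n k
    using mult_right_mono[OF column_bounded_entry[OF A, of n k], of "cmod (u k)"]
    by (simp add: norm_mult mult_ac)
  have "summable (\<lambda>k. cmod (A n k * u k) * exp (\<gamma> * real n))" for n
    by (rule summable_comparison_test'[OF m, of 0]) (use entry in \<open>auto simp: norm_mult\<close>)
  then have "summable (\<lambda>k. cmod (A n k * u k) * exp (\<gamma> * real n) * exp (- (\<gamma> * real n)))" for n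
    by (rule summable_mult2)
  then have abs: "summable (\<lambda>k. cmod (A n k * u k))" for n
    by (simp add: mult.assoc flip: exp_add)
  then show "summable (\<lambda>k. A n k * u k)"
    by (rule summable_norm_cancel)
  have "(\<Sum>n<r. cmod (mat_op A u n) * exp (\<gamma> * real n)) \<le> (\<Sum>k. m k * cmod (u k))" for r
  proof -
    have "(\<Sum>n<r. cmod (mat_op A u n) * exp (\<gamma> * real n))
        \<le> (\<Sum>n<r. (\<Sum>k. cmod (A n k * u k)) * exp (\<gamma> * real n))"
      unfolding mat_op_def by (intro sum_mono mult_right_mono summable_norm abs) simp
    also have "\<dots> = (\<Sum>n<r. (\<Sum>k. cmod (A n k * u k) * exp (\<gamma> * real n)))"
      by (simp add: suminf_mult2 abs)
    also have "\<dots> = (\<Sum>k. \<Sum>n<r. cmod (A n k * u k) * exp (\<gamma> * real n))"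
      by (rule suminf_sum[symmetric]) (intro summable_mult2 abs)
    also have "\<dots> \<le> (\<Sum>k. m k * cmod (u k))"
    proof (rule suminf_le[OF _ _ m])
      show "summable (\<lambda>k. \<Sum>n<r. cmod (A n k * u k) * exp (\<gamma> * real n))"
        by (intro summable_sum summable_mult2 abs)
      fix k
      have "(\<Sum>n<r. cmod (A n k * u k) * exp (\<gamma> * real n))
          = (\<Sum>n<r. cmod (A n k) * exp (\<gamma> * real n)) * cmod (u k)"
        by (simp add: sum_distrib_left norm_mult mult_ac)
      also have "\<dots> \<le> m k * cmod (u k)"
        using partial_sum_le_seq_norm[of "\<lambda>n. A n k" \<gamma> r] A
        by (intro mult_right_mono) (auto simp: column_bounded_iff intro: order_trans)
      finally show "(\<Sum>n<r. cmod (A n k * u k) * exp (\<gamma> * real n)) \<le> m k * cmod (u k)" .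
    qed
    finally show ?thesis .
  qed
  from seq_space_bounded[OF this]
  show "mat_op A u \<in> seq_space \<gamma>" "seq_norm \<gamma> (mat_op A u) \<le> (\<Sum>k. m k * cmod (u k))" .
qed

text \<open>A column bound in the form of the weight of another space of the scale is a bounded
  operator between the two spaces.\<close>

lemma column_bounded_operator:
  assumes A: "column_bounded \<gamma> A (\<lambda>k. L * exp (\<gamma>' * real k))" and u: "u \<in> seq_space \<gamma>'"
  shows "summable (\<lambda>k. A n k * u k)"
    and "mat_op A u \<in> seq_space \<gamma>"
    and "seq_norm \<gamma> (mat_op A u) \<le> L * seq_norm \<gamma>' u"
proof -
  have s: "summable (\<lambda>k. cmod (u k) * exp (\<gamma>' * real k))"
    using u by (simp add: seq_space_def)
  have eq: "(\<lambda>k. L * exp (\<gamma>' * real k) * cmod (u k)) = (\<lambda>k. L * (cmod (u k) * exp (\<gamma>' * real k)))"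
    by (auto simp: mult_ac)
  have s': "summable (\<lambda>k. L * exp (\<gamma>' * real k) * cmod (u k))"
    unfolding eq by (rule summable_mult[OF s])
  note * = column_bounded_mat_op[OF A s']
  show "summable (\<lambda>k. A n k * u k)" "mat_op A u \<in> seq_space \<gamma>" by (rule *)+
  show "seq_norm \<gamma> (mat_op A u) \<le> L * seq_norm \<gamma>' u"
    using *(3) unfolding eq suminf_mult[OF s] seq_norm_def .
qed

lemma mat_op_diff:
  assumes "\<And>n. summable (\<lambda>k. A n k * u k)" "\<And>n. summable (\<lambda>k. A n k * v k)"
  shows "mat_op A (\<lambda>k. u k - v k) n = mat_op A u n - mat_op A v n"
  unfolding mat_op_def by (subst suminf_diff[OF assms]) (simp add: right_diff_distrib)

section \<open>Growth estimates along a decreasing weight\<close>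

text \<open>A mean value inequality for functions that need be neither differentiable nor continuous: the norms to
  which it is applied have a weight that depends on time, so only their right difference quotients
  are under control. Bounded right increments alone do not exclude upward jumps when a point is
  approached from the left; the first condition does.\<close>

lemma right_increment_bound:
  fixes g :: "real \<Rightarrow> real"
  assumes "s \<le> b" "0 \<le> \<delta>"
    and left: "\<And>t \<epsilon>. s < t \<Longrightarrow> t \<le> b \<Longrightarrow> 0 < \<epsilon> \<Longrightarrow> \<forall>\<^sub>F r in at_left t. g t \<le> g r + \<epsilon>"
    and right: "\<And>t \<epsilon>. s \<le> t \<Longrightarrow> t < b \<Longrightarrow> 0 < \<epsilon> \<Longrightarrow>
      \<forall>\<^sub>F r in at_right t. g r \<le> g t + (\<delta> + \<epsilon>) * (r - t)"
  shows "g b \<le> g s + \<delta> * (b - s)"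
proof -
  have main: "g b \<le> g s + (\<delta> + \<epsilon>) * (b - s)" if "0 < \<epsilon>" for \<epsilon>
  proof -
    \<comment> \<open>The bound holds up to a maximal time; it persists at that time by the left condition and
      beyond it by the right one.\<close>
    define P where "P t \<longleftrightarrow> g t \<le> g s + (\<delta> + \<epsilon>) * (t - s)" for t
    define X where "X = {t. s \<le> t \<and> t \<le> b \<and> (\<forall>r. s \<le> r \<and> r \<le> t \<longrightarrow> P r)}"
    have sX: "s \<in> X" using assms(1) by (auto simp: X_def P_def)
    have bdd: "bdd_above X" by (auto simp: X_def intro!: bdd_aboveI[of _ b])
    define t where "t = Sup X"
    have st: "s \<le> t" unfolding t_def by (rule cSup_upper[OF sX bdd])
    have tb: "t \<le> b" unfolding t_def by (rule cSup_least) (use sX in \<open>auto simp: X_def\<close>)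
    have below: "P r" if r: "s \<le> r" "r < t" for r
    proof -
      obtain y where "y \<in> X" "r < y"
        using r(2) less_cSup_iff[OF _ bdd, of r] sX unfolding t_def by blast
      then show ?thesis using r by (auto simp: X_def)
    qed
    have Pt: "P t"
    proof (cases "s < t")
      case True
      have "g t \<le> g s + (\<delta> + \<epsilon>) * (t - s) + e" if "0 < e" for e
      proof -
        have "\<forall>\<^sub>F r in at_left t. r \<in> {s<..<t}"
          using eventually_at_leftI[of s t "\<lambda>r. r \<in> {s<..<t}"] True by auto
        with left[OF True tb that] have "\<forall>\<^sub>F r in at_left t. r \<in> {s<..<t} \<and> g t \<le> g r + e"
          by eventually_elim auto
        then obtain r where r: "s < r" "r < t" "g t \<le> g r + e"
          using eventually_happens'[of "at_left t"] by (auto simp: trivial_limit_at_left_real)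
        have "(\<delta> + \<epsilon>) * (r - s) \<le> (\<delta> + \<epsilon>) * (t - s)"
          using r \<open>0 < \<epsilon>\<close> assms(2) by (intro mult_left_mono) auto
        then show ?thesis using below[of r] r by (simp add: P_def)
      qed
      then show ?thesis unfolding P_def by (rule field_le_epsilon)
    next
      case False
      then show ?thesis using st by (simp add: P_def)
    qed
    have "t = b"
    proof (rule ccontr)
      assume "t \<noteq> b"
      then have "t < b" using tb by simp
      from right[OF st this \<open>0 < \<epsilon>\<close>] obtain y where y: "y > t"
        "\<And>r. t < r \<Longrightarrow> r < y \<Longrightarrow> g r \<le> g t + (\<delta> + \<epsilon>) * (r - t)"
        by (auto simp: eventually_at_right_field)
      define z where "z = min b ((t + y) / 2)"
      have z: "t < z" "z \<le> b" "z < y" using y(1) \<open>t < b\<close> by (auto simp: z_def min_less_iff_disj)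
      have "P r" if "s \<le> r" "r \<le> z" for r
      proof -
        consider "r < t" | "r = t" | "t < r" by linarith
        then show ?thesis
        proof cases
          case 3
          have "g r \<le> g t + (\<delta> + \<epsilon>) * (r - t)" using y(2)[OF 3] that z by simp
          with Pt show ?thesis by (simp add: P_def algebra_simps)
        qed (use below Pt that in auto)
      qed
      then have "z \<in> X" using z st by (auto simp: X_def)
      from cSup_upper[OF this bdd] z show False by (simp add: t_def)
    qed
    with Pt show ?thesis by (simp add: P_def)
  qed
  show ?thesis
  proof (rule field_le_epsilon)
    fix e :: real assume "0 < e"
    define \<epsilon> where "\<epsilon> = e / (1 + (b - s))"
    have e: "0 < \<epsilon>" using \<open>0 < e\<close> assms(1) by (auto simp: \<epsilon>_def)
    have "\<epsilon> * (b - s) \<le> \<epsilon> * (1 + (b - s))" using e by (intro mult_left_mono) auto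
    also have "\<dots> = e" using assms(1) by (simp add: \<epsilon>_def)
    finally show "g b \<le> g s + \<delta> * (b - s) + e"
      using main[OF e] by (simp add: distrib_right)
  qed
qed

text \<open>The matrix without its diagonal drift \<open>- d\<close> has columns of size at most \<open>d\<^sub>k\<close>, which the
  drift absorbs, plus a part of size \<open>E + c k\<close>, which is absorbed by a weight whose exponent
  decreases at speed \<open>c\<close>. One and the same \<open>E\<close> and \<open>c\<close> serve all exponents in
  \<open>(\<alpha>\<^sub>0, \<alpha>]\<close>. The condition \<open>d \<ge> 0\<close> is not strict because truncation sets most of the
  \<open>d\<^sub>n\<close> to zero.\<close>

locale drift_dominated_matrix =
  fixes A :: "nat \<Rightarrow> nat \<Rightarrow> complex" and d :: "nat \<Rightarrow> real" and \<alpha>\<^sub>0 \<alpha> E c :: real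
  assumes d_nonneg: "\<And>n. 0 \<le> d n"
    and E_nonneg: "0 \<le> E"
    and c_pos: "0 < c"
    and growth: "\<And>\<nu>. 0 < \<nu> \<Longrightarrow> \<exists>C. \<forall>n. d n \<le> C * exp (\<nu> * real n)"
    and columns: "\<And>\<gamma>. \<alpha>\<^sub>0 < \<gamma> \<Longrightarrow> \<gamma> \<le> \<alpha> \<Longrightarrow>
      column_bounded \<gamma> (\<lambda>n k. A n k + of_bool (n = k) * of_real (d k))
        (\<lambda>k. (d k + (E + c * real k)) * exp (\<gamma> * real k))"
begin

text \<open>The drift, its square and the linear term grow more slowly than any exponential, so each of them
  costs only an arbitrarily small loss in the exponent of the space.\<close>

lemma growth_bounds:
  assumes "0 < \<nu>"
  obtains L where "0 \<le> L"
    "\<And>n. (d n)\<^sup>2 \<le> L * exp (\<nu> * real n)"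
    "\<And>n. 2 * d n + (E + c * real n) \<le> L * exp (\<nu> * real n)"
proof -
  obtain C where C: "\<And>n. d n \<le> C * exp (\<nu> * real n)" using growth[OF assms] by blast
  obtain C' where C': "\<And>n. d n \<le> C' * exp (\<nu> / 2 * real n)"
    using growth[of "\<nu> / 2"] assms by auto
  have C0: "0 \<le> C" using C[of 0] d_nonneg[of 0] by simp
  define L where "L = C'\<^sup>2 + (2 * C + E + c / \<nu>)"
  have L: "C'\<^sup>2 \<le> L" "2 * C + E + c / \<nu> \<le> L"
    using C0 E_nonneg c_pos assms by (auto simp: L_def)
  show thesis
  proof
    show "0 \<le> L" using L(1) by (rule order_trans[rotated]) simp
    fix n
    have "(d n)\<^sup>2 \<le> (C' * exp (\<nu> / 2 * real n))\<^sup>2"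
      by (intro power_mono C' d_nonneg)
    also have "\<dots> = C'\<^sup>2 * exp (\<nu> * real n)"
      by (simp add: power_mult_distrib power2_eq_square[of "exp _"] flip: exp_add)
    also have "\<dots> \<le> L * exp (\<nu> * real n)"
      using L by (intro mult_right_mono) auto
    finally show "(d n)\<^sup>2 \<le> L * exp (\<nu> * real n)" .
    have "c * real n = c / \<nu> * (\<nu> * real n)" using assms by simp
    also have "\<dots> \<le> c / \<nu> * exp (\<nu> * real n)"
    proof (rule mult_left_mono)
      show "\<nu> * real n \<le> exp (\<nu> * real n)"
        using exp_ge_add_one_self[of "\<nu> * real n"] by linarith
    qed (use c_pos assms in auto)
    finally have "c * real n \<le> c / \<nu> * exp (\<nu> * real n)" .
    moreover have "E \<le> E * exp (\<nu> * real n)"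
      using E_nonneg assms by (simp add: mult_le_cancel_left1)
    ultimately have "2 * d n + (E + c * real n) \<le> (2 * C + E + c / \<nu>) * exp (\<nu> * real n)"
      using C[of n] by (simp add: distrib_right)
    also have "\<dots> \<le> L * exp (\<nu> * real n)"
      using L by (intro mult_right_mono) auto
    finally show "2 * d n + (E + c * real n) \<le> L * exp (\<nu> * real n)" .
  qed
qed

lemma operator_columns:
  assumes "0 < \<nu>"
  obtains L where "0 \<le> L"
    "\<And>\<gamma>. \<alpha>\<^sub>0 < \<gamma> \<Longrightarrow> \<gamma> \<le> \<alpha> \<Longrightarrow> column_bounded \<gamma> A (\<lambda>k. L * exp ((\<gamma> + \<nu>) * real k))"
proof -
  obtain L where L: "0 \<le> L" "\<And>n. 2 * d n + (E + c * real n) \<le> L * exp (\<nu> * real n)"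
    using growth_bounds[OF assms] by metis
  have "column_bounded \<gamma> A (\<lambda>k. L * exp ((\<gamma> + \<nu>) * real k))" if "\<alpha>\<^sub>0 < \<gamma>" "\<gamma> \<le> \<alpha>" for \<gamma>
  proof -
    have "column_bounded \<gamma> (\<lambda>n k. of_bool (n = k) * (- of_real (d k))) (\<lambda>k. d k * exp (\<gamma> * real k))"
      by (rule column_bounded_diag) (simp add: d_nonneg)
    from column_bounded_add[OF columns[OF that] this] show ?thesis
    proof (rule column_bounded_mono)
      fix k
      have "(2 * d k + (E + c * real k)) * exp (\<gamma> * real k) \<le> L * exp (\<nu> * real k) * exp (\<gamma> * real k)"
        by (intro mult_right_mono L) simp
      then show "(d k + (E + c * real k)) * exp (\<gamma> * real k) + d k * exp (\<gamma> * real k)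
          \<le> L * exp ((\<gamma> + \<nu>) * real k)"
        by (simp add: algebra_simps flip: exp_add)
    qed simp
  qed
  with L(1) show thesis by (rule that)
qed

lemma mat_op_in_space:
  assumes "u \<in> seq_space \<gamma>'" "\<alpha>\<^sub>0 < \<gamma>" "\<gamma> < \<gamma>'" "\<gamma> \<le> \<alpha>"
  shows "mat_op A u \<in> seq_space \<gamma>" and "summable (\<lambda>k. A n k * u k)"
proof -
  obtain L where "column_bounded \<gamma> A (\<lambda>k. L * exp ((\<gamma> + (\<gamma>' - \<gamma>)) * real k))"
    using operator_columns[of "\<gamma>' - \<gamma>"] assms by (metis diff_gt_0_iff_gt)
  then have A: "column_bounded \<gamma> A (\<lambda>k. L * exp (\<gamma>' * real k))" by simp
  show "mat_op A u \<in> seq_space \<gamma>" and "summable (\<lambda>k. A n k * u k)"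
    using column_bounded_operator[OF A assms(1)] by auto
qed

text \<open>This is where the drift and the moving weight do their work. The \<open>k\<close>-th column of
  \<open>1 + h A\<close> has, up to the factor \<open>e\<^sup>\<gamma>\<^sup>k\<close>, size at most
  \<open>|1 - h d\<^sub>k| + h d\<^sub>k + h (E + c k)\<close> at the lower exponent, where the weight is smaller by the factor
  \<open>e\<^sup>-\<^sup>c\<^sup>h\<^sup>k\<close>. The first two terms add up to 1 as long as \<open>h d\<^sub>k \<le> 1\<close>; in the other columns
  the excess is at most \<open>(h d\<^sub>k)\<^sup>2\<close>, which is of second order in \<open>h\<close> for a fixed
  sequence. The remaining factor is
  \<open>1 + h (E + c k) \<le> e\<^sup>h\<^sup>(\<^sup>E\<^sup>+\<^sup>c\<^sup>k\<^sup>)\<close>, which the smaller weight and the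
  prefactor \<open>e\<^sup>-\<^sup>E\<^sup>h\<close> cancel.\<close>

lemma Euler_step:
  assumes u: "u \<in> seq_space \<gamma>'" and \<gamma>: "\<gamma> < \<gamma>'" "\<gamma> \<le> \<alpha>" and h: "0 \<le> h" "\<alpha>\<^sub>0 < \<gamma> - c * h"
  defines "S \<equiv> (\<Sum>k. (d k)\<^sup>2 * cmod (u k) * exp (\<gamma> * real k))"
  shows "summable (\<lambda>k. (d k)\<^sup>2 * cmod (u k) * exp (\<gamma> * real k))"
    and "(\<lambda>n. u n + of_real h * mat_op A u n) \<in> seq_space (\<gamma> - c * h)"
    and "exp (- E * h) * seq_norm (\<gamma> - c * h) (\<lambda>n. u n + of_real h * mat_op A u n)
          \<le> seq_norm \<gamma> u + h\<^sup>2 * S"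
proof -
  define \<eta> where "\<eta> = \<gamma> - c * h"
  have \<eta>: "\<eta> \<le> \<gamma>" "\<alpha>\<^sub>0 < \<eta>" using h c_pos by (auto simp: \<eta>_def)
  obtain L where L: "0 \<le> L" "\<And>n. (d n)\<^sup>2 \<le> L * exp ((\<gamma>' - \<gamma>) * real n)"
    using growth_bounds[of "\<gamma>' - \<gamma>"] \<gamma> by (metis diff_gt_0_iff_gt)
  show sumS: "summable (\<lambda>k. (d k)\<^sup>2 * cmod (u k) * exp (\<gamma> * real k))"
  proof (rule summable_comparison_test'[of "\<lambda>k. L * (cmod (u k) * exp (\<gamma>' * real k))" 0])
    show "summable (\<lambda>k. L * (cmod (u k) * exp (\<gamma>' * real k)))"
      using u by (intro summable_mult) (simp add: seq_space_def)
    fix n :: nat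
    have "(d n)\<^sup>2 * (cmod (u n) * exp (\<gamma> * real n)) \<le> L * exp ((\<gamma>' - \<gamma>) * real n) * (cmod (u n) * exp (\<gamma> * real n))"
      by (intro mult_right_mono L) simp
    also have "\<dots> = L * (cmod (u n) * exp (\<gamma>' * real n))"
      by (simp add: algebra_simps flip: exp_add)
    finally show "norm ((d n)\<^sup>2 * cmod (u n) * exp (\<gamma> * real n)) \<le> L * (cmod (u n) * exp (\<gamma>' * real n))"
      by (simp add: mult.assoc)
  qed
  have sumu: "summable (\<lambda>k. cmod (u k) * exp (\<gamma> * real k))"
    using seq_space_mono(1)[OF u, of \<gamma>] \<gamma> by (simp add: seq_space_def)

  define R where "R n k = of_bool (n = k) * of_real (1 - h * d k) +
      of_real h * (A n k + of_bool (n = k) * of_real (d k))" for n k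
  define m where "m k = (\<bar>1 - h * d k\<bar> + h * (d k + (E + c * real k))) * exp (\<eta> * real k)" for k
  have R: "column_bounded \<eta> R m"
  proof -
    have "column_bounded \<eta> (\<lambda>n k. of_bool (n = k) * complex_of_real (1 - h * d k))
        (\<lambda>k. \<bar>1 - h * d k\<bar> * exp (\<eta> * real k))"
      by (rule column_bounded_diag) (metis norm_of_real order_refl)
    from column_bounded_add[OF this column_bounded_scale[OF columns[of \<eta>], of "of_real h"]]
    show ?thesis
      using \<eta> \<gamma> h unfolding R_def m_def
      by (simp add: distrib_right mult.assoc)
  qed
  have m_nonneg: "0 \<le> m k" for k
    using h d_nonneg[of k] E_nonneg c_pos by (auto simp: m_def)
  have m: "exp (- E * h) * m k \<le> (1 + h\<^sup>2 * (d k)\<^sup>2) * exp (\<gamma> * real k)" for k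
  proof -
    define x where "x = h * d k"
    define y where "y = h * (E + c * real k)"
    have xy: "0 \<le> x" "0 \<le> y"
      using h d_nonneg[of k] E_nonneg c_pos by (auto simp: x_def y_def)
    have "\<bar>1 - x\<bar> + x \<le> 1 + x\<^sup>2"
    proof (cases "x \<le> 1")
      case False
      have "0 \<le> (x - 1)\<^sup>2" by simp
      with False show ?thesis by (simp add: power2_eq_square algebra_simps)
    qed simp
    then have "\<bar>1 - x\<bar> + x + y \<le> 1 + x\<^sup>2 + y" by simp
    also have "\<dots> \<le> (1 + x\<^sup>2) * (1 + y)" using xy by (simp add: algebra_simps)
    also have "\<dots> \<le> (1 + x\<^sup>2) * exp y"
      by (intro mult_left_mono exp_ge_add_one_self) (simp add: add_nonneg_nonneg)
    finally have "(\<bar>1 - x\<bar> + x + y) * (exp (- y) * exp (\<gamma> * real k))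
        \<le> (1 + x\<^sup>2) * exp y * (exp (- y) * exp (\<gamma> * real k))"
      by (rule mult_right_mono) simp
    also have "\<dots> = (1 + x\<^sup>2) * exp (\<gamma> * real k)"
      by (simp add: exp_minus)
    finally have *: "(\<bar>1 - x\<bar> + x + y) * (exp (- y) * exp (\<gamma> * real k)) \<le> (1 + x\<^sup>2) * exp (\<gamma> * real k)" .
    have "exp (- y) * exp (\<gamma> * real k) = exp (- E * h) * exp (\<eta> * real k)"
      by (simp add: y_def \<eta>_def algebra_simps flip: exp_add)
    from *[unfolded this] show ?thesis
      by (simp add: m_def x_def y_def power_mult_distrib distrib_left mult_ac add_ac)
  qed
  have summ: "summable (\<lambda>k. m k * cmod (u k))"
  proof -
    have "summable (\<lambda>k. exp (E * h) * (cmod (u k) * exp (\<gamma> * real k) + h\<^sup>2 * ((d k)\<^sup>2 * cmod (u k) * exp (\<gamma> * real k))))"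
      by (intro summable_mult summable_add sumS sumu)
    then show ?thesis
    proof (rule summable_comparison_test'[of _ 0])
      fix k :: nat
      have "m k = exp (E * h) * (exp (- E * h) * m k)"
        by (simp add: exp_minus)
      also have "\<dots> \<le> exp (E * h) * ((1 + h\<^sup>2 * (d k)\<^sup>2) * exp (\<gamma> * real k))"
        by (intro mult_left_mono m) simp
      finally have "m k * cmod (u k) \<le> exp (E * h) * ((1 + h\<^sup>2 * (d k)\<^sup>2) * exp (\<gamma> * real k)) * cmod (u k)"
        by (rule mult_right_mono) simp
      then show "norm (m k * cmod (u k)) \<le> exp (E * h) * (cmod (u k) * exp (\<gamma> * real k) + h\<^sup>2 * ((d k)\<^sup>2 * cmod (u k) * exp (\<gamma> * real k)))"
        using m_nonneg[of k] by (simp add: algebra_simps)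
    qed
  qed
  note Ru = column_bounded_mat_op[OF R summ]
  have R_eq: "mat_op R u = (\<lambda>n. u n + of_real h * mat_op A u n)"
  proof
    fix n
    have "summable (\<lambda>k. A n k * u k)"
      using mat_op_in_space(2)[OF seq_space_mono(1)[OF u order_refl], of \<gamma>] \<gamma> \<eta> by auto
    then have A: "(\<lambda>k. of_real h * (A n k * u k)) sums (of_real h * mat_op A u n)"
      unfolding mat_op_def by (intro sums_mult summable_sums)
    have "(\<lambda>k. if k = n then u k else 0) sums u n" by (rule sums_single)
    from sums_add[OF this A] have "(\<lambda>k. R n k * u k) sums (u n + of_real h * mat_op A u n)"
      by (rule sums_cong[THEN iffD1, rotated]) (auto simp: R_def algebra_simps)
    then show "mat_op R u n = u n + of_real h * mat_op A u n"
      unfolding mat_op_def[of R] by (simp add: sums_iff)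
  qed
  show "(\<lambda>n. u n + of_real h * mat_op A u n) \<in> seq_space (\<gamma> - c * h)"
    using Ru(2) by (simp add: R_eq \<eta>_def)
  have "exp (- E * h) * seq_norm \<eta> (mat_op R u) \<le> exp (- E * h) * (\<Sum>k. m k * cmod (u k))"
    by (intro mult_left_mono Ru(3)) simp
  also have "\<dots> = (\<Sum>k. exp (- E * h) * (m k * cmod (u k)))"
    by (rule suminf_mult[OF summ, symmetric])
  also have "\<dots> \<le> (\<Sum>k. cmod (u k) * exp (\<gamma> * real k) + h\<^sup>2 * ((d k)\<^sup>2 * cmod (u k) * exp (\<gamma> * real k)))"
  proof (rule suminf_le[OF _ summable_mult[OF summ] summable_add[OF sumu summable_mult[OF sumS]]])
    fix k
    show "exp (- E * h) * (m k * cmod (u k)) \<le> cmod (u k) * exp (\<gamma> * real k) + h\<^sup>2 * ((d k)\<^sup>2 * cmod (u k) * exp (\<gamma> * real k))"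
      using mult_right_mono[OF m[of k], of "cmod (u k)"] by (simp add: algebra_simps)
  qed
  also have "\<dots> = seq_norm \<gamma> u + h\<^sup>2 * S"
    unfolding S_def seq_norm_def
    by (simp add: suminf_add[symmetric] suminf_mult sumu sumS summable_mult)
  finally show "exp (- E * h) * seq_norm (\<gamma> - c * h) (\<lambda>n. u n + of_real h * mat_op A u n)
      \<le> seq_norm \<gamma> u + h\<^sup>2 * S"
    by (simp add: R_eq \<eta>_def)
qed

end

section \<open>Derivatives in the scale of spaces\<close>

lemma seq_has_derivative_subset:
  assumes "seq_has_derivative \<alpha> I u v t" "J \<subseteq> I"
  shows "seq_has_derivative \<alpha> J u v t"
  using assms unfolding seq_has_derivative_def by (blast intro: tendsto_within_subset)

lemma seq_has_derivative_diff:
  assumes "seq_has_derivative \<alpha> I u u' t" "seq_has_derivative \<alpha> I v v' t" "t \<in> I"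
  shows "seq_has_derivative \<alpha> I (\<lambda>s n. u s n - v s n) (\<lambda>n. u' n - v' n) t"
proof -
  define Q where "Q u u' s n = (u s n - u t n) / of_real (s - t) - u' n"
    for u :: "real \<Rightarrow> nat \<Rightarrow> complex" and u' s n
  have spaces: "\<And>s. s \<in> I \<Longrightarrow> u s \<in> seq_space \<alpha>" "u' \<in> seq_space \<alpha>"
     "\<And>s. s \<in> I \<Longrightarrow> v s \<in> seq_space \<alpha>" "v' \<in> seq_space \<alpha>"
    and lim: "((\<lambda>s. seq_norm \<alpha> (Q u u' s)) \<longlongrightarrow> 0) (at t within I)"
      "((\<lambda>s. seq_norm \<alpha> (Q v v' s)) \<longlongrightarrow> 0) (at t within I)"
    using assms(1,2) by (auto simp: seq_has_derivative_def Q_def[abs_def])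
  have Qspace: "Q u u' s \<in> seq_space \<alpha>" "Q v v' s \<in> seq_space \<alpha>" if "s \<in> I" for s
    unfolding Q_def[abs_def] divide_inverse mult.commute[of _ "inverse _"]
    by (intro seq_diff(1) seq_scale(1) spaces that assms(3))+
  let ?D = "\<lambda>s n. (u s n - v s n - (u t n - v t n)) / of_real (s - t) - (u' n - v' n)"
  have eq: "?D s = (\<lambda>n. Q u u' s n - Q v v' s n)" for s
    by (auto simp: Q_def diff_divide_distrib)
  have "((\<lambda>s. seq_norm \<alpha> (?D s)) \<longlongrightarrow> 0) (at t within I)"
  proof (rule tendsto_sandwich[OF _ _ tendsto_const])
    show "((\<lambda>s. seq_norm \<alpha> (Q u u' s) + seq_norm \<alpha> (Q v v' s)) \<longlongrightarrow> 0) (at t within I)"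
      using tendsto_add[OF lim] by simp
    show "\<forall>\<^sub>F s in at t within I. 0 \<le> seq_norm \<alpha> (?D s)"
      unfolding eq by (auto simp: eventually_at_filter intro!: always_eventually seq_norm_nonneg seq_diff Qspace)
    show "\<forall>\<^sub>F s in at t within I. seq_norm \<alpha> (?D s) \<le> seq_norm \<alpha> (Q u u' s) + seq_norm \<alpha> (Q v v' s)"
      unfolding eq by (auto simp: eventually_at_filter intro!: always_eventually seq_diff Qspace)
  qed
  then show ?thesis
    unfolding seq_has_derivative_def by (auto intro!: seq_diff spaces)
qed

text \<open>The first-order expansion: it removes the division by \<open>s - t\<close> from the definition of the
  derivative.\<close>

lemma seq_has_derivative_remainder:
  assumes "seq_has_derivative \<alpha> I u v t" "t \<in> I"
  obtains \<rho> where
    "\<And>s. s \<in> I \<Longrightarrow> \<rho> s \<in> seq_space \<alpha>"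
    "((\<lambda>s. seq_norm \<alpha> (\<rho> s)) \<longlongrightarrow> 0) (at t within I)"
    "\<And>s n. s \<noteq> t \<Longrightarrow> u s n = u t n + of_real (s - t) * (v n + \<rho> s n)"
proof
  let ?\<rho> = "\<lambda>s n. (u s n - u t n) / of_real (s - t) - v n"
  show "((\<lambda>s. seq_norm \<alpha> (?\<rho> s)) \<longlongrightarrow> 0) (at t within I)"
    using assms by (simp add: seq_has_derivative_def)
  have spaces: "\<And>s. s \<in> I \<Longrightarrow> u s \<in> seq_space \<alpha>" "v \<in> seq_space \<alpha>"
    using assms by (auto simp: seq_has_derivative_def)
  show "?\<rho> s \<in> seq_space \<alpha>" if "s \<in> I" for s
    unfolding divide_inverse mult.commute[of _ "inverse _"]
    by (intro seq_diff(1) seq_scale(1) spaces that assms(2))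
  show "u s n = u t n + of_real (s - t) * (v n + ?\<rho> s n)" if "s \<noteq> t" for s n
    using that by simp
qed

lemma seq_has_derivative_tendsto:
  assumes "seq_has_derivative \<alpha> I u v t" "t \<in> I"
  shows "((\<lambda>s. seq_norm \<alpha> (\<lambda>n. u s n - u t n)) \<longlongrightarrow> 0) (at t within I)"
proof -
  obtain \<rho> where \<rho>: "\<And>s. s \<in> I \<Longrightarrow> \<rho> s \<in> seq_space \<alpha>"
    "((\<lambda>s. seq_norm \<alpha> (\<rho> s)) \<longlongrightarrow> 0) (at t within I)"
    "\<And>s n. s \<noteq> t \<Longrightarrow> u s n = u t n + of_real (s - t) * (v n + \<rho> s n)"
    using seq_has_derivative_remainder[OF assms] by metis
  have spaces: "\<And>s. s \<in> I \<Longrightarrow> u s \<in> seq_space \<alpha>" "v \<in> seq_space \<alpha>"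
    using assms by (auto simp: seq_has_derivative_def)
  show ?thesis
  proof (rule tendsto_sandwich[OF _ _ tendsto_const])
    show "\<forall>\<^sub>F s in at t within I. 0 \<le> seq_norm \<alpha> (\<lambda>n. u s n - u t n)"
      by (auto simp: eventually_at_filter intro!: always_eventually seq_norm_nonneg seq_diff spaces assms)
    have "((\<lambda>s. \<bar>s - t\<bar> * (seq_norm \<alpha> v + seq_norm \<alpha> (\<rho> s))) \<longlongrightarrow> \<bar>t - t\<bar> * (seq_norm \<alpha> v + 0)) (at t within I)"
      by (intro tendsto_intros \<rho>(2))
    then show "((\<lambda>s. \<bar>s - t\<bar> * (seq_norm \<alpha> v + seq_norm \<alpha> (\<rho> s))) \<longlongrightarrow> 0) (at t within I)"
      by simp
    have "seq_norm \<alpha> (\<lambda>n. u s n - u t n) \<le> \<bar>s - t\<bar> * (seq_norm \<alpha> v + seq_norm \<alpha> (\<rho> s))"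
      if "s \<noteq> t" "s \<in> I" for s
    proof -
      have "seq_norm \<alpha> (\<lambda>n. u s n - u t n) = seq_norm \<alpha> (\<lambda>n. of_real (s - t) * (v n + \<rho> s n))"
        using \<rho>(3)[OF that(1)] by simp
      also have "\<dots> = \<bar>s - t\<bar> * seq_norm \<alpha> (\<lambda>n. v n + \<rho> s n)"
        by (subst seq_scale(2)[OF seq_add(1)[OF spaces(2) \<rho>(1)[OF that(2)]]]) (simp add: norm_of_real del: of_real_diff)
      also have "\<dots> \<le> \<bar>s - t\<bar> * (seq_norm \<alpha> v + seq_norm \<alpha> (\<rho> s))"
        by (intro mult_left_mono seq_add spaces \<rho> that) simp
      finally show ?thesis .
    qed
    then show "\<forall>\<^sub>F s in at t within I. seq_norm \<alpha> (\<lambda>n. u s n - u t n) \<le> \<bar>s - t\<bar> * (seq_norm \<alpha> v + seq_norm \<alpha> (\<rho> s))"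
      by (auto simp: eventually_at_filter intro!: always_eventually)
  qed
qed

context drift_dominated_matrix
begin

text \<open>The a priori estimate on which the whole proof rests. By \<open>Euler_step\<close> the right difference
  quotients of \<open>e\<^sup>-\<^sup>E\<^sup>(\<^sup>t\<^sup>-\<^sup>s\<^sup>) \<parallel>w(t)\<parallel>\<close>, taken with the exponent
  \<open>\<beta> - c (t - s)\<close>, exceed \<open>\<delta>\<close> by an arbitrarily small amount only. The derivative is taken in
  the initial space \<open>\<beta>\<close>, whereas the values of \<open>w\<close> lie in a smaller space \<open>\<beta>'\<close>; this
  makes the second-order term of the Euler step finite.\<close>

lemma moving_weight_estimate:
  assumes sb: "s \<le> b" and low: "\<alpha>\<^sub>0 < \<beta> - c * (b - s)" and up: "\<beta> < \<beta>'" "\<beta> \<le> \<alpha>"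
    and w: "\<And>t. t \<in> {s..b} \<Longrightarrow> w t \<in> seq_space \<beta>'"
    and f: "\<And>t. t \<in> {s..b} \<Longrightarrow> f t \<in> seq_space \<beta>"
    and der: "\<And>t. t \<in> {s..b} \<Longrightarrow> seq_has_derivative \<beta> {s..b} w (\<lambda>n. mat_op A (w t) n + f t n) t"
    and \<delta>: "\<And>t. t \<in> {s..b} \<Longrightarrow> seq_norm (\<beta> - c * (t - s)) (f t) \<le> \<delta>"
  shows "seq_norm (\<beta> - c * (b - s)) (w b) \<le> exp (E * (b - s)) * (seq_norm \<beta> (w s) + \<delta> * (b - s))"
proof -
  define B where "B t = \<beta> - c * (t - s)" for t
  define g where "g t = exp (- E * (t - s)) * seq_norm (B t) (w t)" for t
  have B: "B t \<le> \<beta>" "\<alpha>\<^sub>0 < B t" if "t \<in> {s..b}" for t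
  proof -
    have "c * (t - s) \<le> c * (b - s)" "0 \<le> c * (t - s)" using that c_pos by auto
    then show "B t \<le> \<beta>" "\<alpha>\<^sub>0 < B t" using low by (auto simp: B_def)
  qed
  have w\<beta>: "w t \<in> seq_space \<beta>" if "t \<in> {s..b}" for t
    using seq_space_mono(1)[OF w[OF that]] up by simp
  have \<delta>0: "0 \<le> \<delta>"
  proof -
    have "s \<in> {s..b}" using sb by simp
    from seq_norm_nonneg[OF seq_space_mono(1)[OF f[OF this] B(1)[OF this]]] \<delta>[OF this]
    show ?thesis unfolding B_def by linarith
  qed
  have "g b \<le> g s + \<delta> * (b - s)"
  proof (rule right_increment_bound[OF sb \<delta>0])
    fix t \<epsilon> :: real
    assume t: "s < t" "t \<le> b" and \<epsilon>: "0 < \<epsilon>"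
    \<comment> \<open>Before time t the weight is larger than at t, so the change of the weight works in the
      right direction and only the continuity of w in norm is needed.\<close>
    have "((\<lambda>r. seq_norm \<beta> (\<lambda>n. w r n - w t n)) \<longlongrightarrow> 0) (at t within {s..t})"
      using t by (intro tendsto_within_subset[OF seq_has_derivative_tendsto[OF der]]) auto
    then have "((\<lambda>r. seq_norm \<beta> (\<lambda>n. w r n - w t n)) \<longlongrightarrow> 0) (at_left t)"
      using at_within_Icc_at_left[OF t(1)] by simp
    from order_tendstoD(2)[OF this \<epsilon>]
    have 1: "\<forall>\<^sub>F r in at_left t. seq_norm \<beta> (\<lambda>n. w r n - w t n) < \<epsilon>" .
    have 2: "\<forall>\<^sub>F r in at_left t. r \<in> {s<..<t}"
      using eventually_at_leftI[of s t "\<lambda>r. r \<in> {s<..<t}"] t by auto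
    show "\<forall>\<^sub>F r in at_left t. g t \<le> g r + \<epsilon>"
      using 1 2
    proof eventually_elim
      case (elim r)
      have I: "t \<in> {s..b}" "r \<in> {s..b}" using t elim by auto
      have Brt: "B t \<le> B r" using elim c_pos by (auto simp: B_def)
      have wr: "w r \<in> seq_space (B t)" "w r \<in> seq_space (B r)" "w t \<in> seq_space (B t)"
        using seq_space_mono(1)[OF w\<beta>] I B by auto
      have "seq_norm (B t) (w t) \<le> seq_norm (B t) (w r) + seq_norm (B t) (\<lambda>n. w r n - w t n)"
        by (intro seq_triangle(2) seq_diff(1) wr) (metis norm_minus_commute norm_triangle_sub)
      also have "seq_norm (B t) (w r) \<le> seq_norm (B r) (w r)"
        by (rule seq_space_mono(2)[OF wr(2) Brt])
      also have "seq_norm (B t) (\<lambda>n. w r n - w t n) \<le> seq_norm \<beta> (\<lambda>n. w r n - w t n)"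
        by (rule seq_space_mono(2)[OF seq_diff(1)[OF w\<beta> w\<beta>]]) (use I B in auto)
      finally have "seq_norm (B t) (w t) \<le> seq_norm (B r) (w r) + \<epsilon>"
        using elim by linarith
      then have "g t \<le> exp (- E * (t - s)) * (seq_norm (B r) (w r) + \<epsilon>)"
        unfolding g_def by (rule mult_left_mono) simp
      also have "\<dots> = exp (- E * (t - s)) * seq_norm (B r) (w r) + exp (- E * (t - s)) * \<epsilon>"
        by (rule distrib_left)
      also have "\<dots> \<le> g r + 1 * \<epsilon>"
        unfolding g_def using elim t E_nonneg \<epsilon> seq_norm_nonneg[OF wr(2)]
        by (intro add_mono mult_right_mono) (auto simp: mult_left_mono)
      finally show ?case by simp
    qed
  next
    fix t \<epsilon> :: real
    assume t: "s \<le> t" "t < b" and \<epsilon>: "0 < \<epsilon>"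
    have I: "t \<in> {s..b}" using t by auto
    define S where "S = (\<Sum>k. (d k)\<^sup>2 * cmod (w t k) * exp (B t * real k))"
    obtain \<rho> where \<rho>: "\<And>r. r \<in> {s..b} \<Longrightarrow> \<rho> r \<in> seq_space \<beta>"
      "((\<lambda>r. seq_norm \<beta> (\<rho> r)) \<longlongrightarrow> 0) (at t within {s..b})"
      "\<And>r n. r \<noteq> t \<Longrightarrow> w r n = w t n + of_real (r - t) * (mat_op A (w t) n + f t n + \<rho> r n)"
      using seq_has_derivative_remainder[OF der[OF I] I] by metis
    have "((\<lambda>r. seq_norm \<beta> (\<rho> r)) \<longlongrightarrow> 0) (at t within {t..b})"
      using t by (intro tendsto_within_subset[OF \<rho>(2)]) auto
    then have lim: "((\<lambda>r. seq_norm \<beta> (\<rho> r)) \<longlongrightarrow> 0) (at_right t)"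
      using at_within_Icc_at_right[OF t(2)] by simp
    have "((\<lambda>r. (r - t) * S + seq_norm \<beta> (\<rho> r)) \<longlongrightarrow> (t - t) * S + 0) (at_right t)"
      by (intro tendsto_intros lim)
    from order_tendstoD(2)[OF this, of \<epsilon>]
    have 1: "\<forall>\<^sub>F r in at_right t. (r - t) * S + seq_norm \<beta> (\<rho> r) < \<epsilon>" using \<epsilon> by simp
    have 2: "\<forall>\<^sub>F r in at_right t. r \<in> {t<..<b}"
      using eventually_at_rightI[of t b "\<lambda>r. r \<in> {t<..<b}"] t by auto
    show "\<forall>\<^sub>F r in at_right t. g r \<le> g t + (\<delta> + \<epsilon>) * (r - t)"
      using 1 2
    proof eventually_elim
      case (elim r)
      define h where "h = r - t"
      have h: "0 < h" using elim by (simp add: h_def)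
      have Ir: "r \<in> {s..b}" using t elim by auto
      have Br: "B r = B t - c * h" by (simp add: B_def h_def algebra_simps)
      have Brt: "B r \<le> B t" using h c_pos by (simp add: Br)
      have Bt: "B t < \<beta>'" "B t \<le> \<alpha>" "0 \<le> h" "\<alpha>\<^sub>0 < B t - c * h"
        using B[OF I] B[OF Ir] up h unfolding Br by auto
      note Euler = Euler_step[OF w[OF I] Bt]
      have fr: "f t \<in> seq_space (B r)" "\<rho> r \<in> seq_space (B r)" "f t \<in> seq_space (B t)"
        using seq_space_mono(1)[OF f[OF I]] seq_space_mono(1)[OF \<rho>(1)[OF Ir]] B I Ir by auto
      have "seq_norm (B r) (w r) \<le> seq_norm (B r) (\<lambda>n. w t n + of_real h * mat_op A (w t) n)
          + seq_norm (B r) (\<lambda>n. of_real h * (f t n + \<rho> r n))"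
      proof (rule seq_triangle(2))
        fix n
        have "w r n = w t n + of_real h * mat_op A (w t) n + of_real h * (f t n + \<rho> r n)"
          using \<rho>(3)[of r n] elim by (simp add: h_def algebra_simps)
        then show "cmod (w r n) \<le> cmod (w t n + of_real h * mat_op A (w t) n) + cmod (of_real h * (f t n + \<rho> r n))"
          by (metis norm_triangle_ineq)
      qed (use Euler(2) in \<open>simp_all add: Br seq_scale(1) seq_add(1) fr[unfolded Br]\<close>)
      also have "seq_norm (B r) (\<lambda>n. of_real h * (f t n + \<rho> r n)) = h * seq_norm (B r) (\<lambda>n. f t n + \<rho> r n)"
        by (subst seq_scale(2)[OF seq_add(1)[OF fr(1,2)]]) (use h in simp)
      also have "\<dots> \<le> h * (seq_norm (B r) (f t) + seq_norm (B r) (\<rho> r))"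
        using h by (intro mult_left_mono seq_add fr) auto
      also have "\<dots> \<le> h * (\<delta> + seq_norm \<beta> (\<rho> r))"
      proof (intro mult_left_mono add_mono)
        show "seq_norm (B r) (f t) \<le> \<delta>"
          using seq_space_mono(2)[OF fr(3) Brt] \<delta>[OF I] by (simp add: B_def)
        show "seq_norm (B r) (\<rho> r) \<le> seq_norm \<beta> (\<rho> r)"
          by (rule seq_space_mono(2)[OF \<rho>(1)[OF Ir] B(1)[OF Ir]])
      qed (use h in simp)
      finally have "exp (- E * h) * seq_norm (B r) (w r) \<le>
          exp (- E * h) * (seq_norm (B r) (\<lambda>n. w t n + of_real h * mat_op A (w t) n) + h * (\<delta> + seq_norm \<beta> (\<rho> r)))"
        by (intro mult_left_mono) auto
      also have "\<dots> \<le> (seq_norm (B t) (w t) + h\<^sup>2 * S) + 1 * (h * (\<delta> + seq_norm \<beta> (\<rho> r)))"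
        unfolding distrib_left[of "exp (- E * h)"]
      proof (rule add_mono)
        show "exp (- E * h) * seq_norm (B r) (\<lambda>n. w t n + of_real h * mat_op A (w t) n) \<le> seq_norm (B t) (w t) + h\<^sup>2 * S"
          using Euler(3) by (simp add: Br S_def)
        show "exp (- E * h) * (h * (\<delta> + seq_norm \<beta> (\<rho> r))) \<le> 1 * (h * (\<delta> + seq_norm \<beta> (\<rho> r)))"
          using h E_nonneg \<delta>0 seq_norm_nonneg[OF \<rho>(1)[OF Ir]] by (intro mult_right_mono) auto
      qed
      also have "\<dots> = seq_norm (B t) (w t) + h * (\<delta> + (h * S + seq_norm \<beta> (\<rho> r)))"
        by (simp add: power2_eq_square algebra_simps)
      also have "\<dots> \<le> seq_norm (B t) (w t) + h * (\<delta> + \<epsilon>)"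
        using elim h by (auto simp: h_def)
      finally have "exp (- E * (t - s)) * (exp (- E * h) * seq_norm (B r) (w r))
          \<le> exp (- E * (t - s)) * (seq_norm (B t) (w t) + h * (\<delta> + \<epsilon>))"
        by (rule mult_left_mono) simp
      also have "\<dots> \<le> g t + 1 * (h * (\<delta> + \<epsilon>))"
        unfolding g_def distrib_left[of "exp (- E * (t - s))"]
        using t h E_nonneg \<delta>0 \<epsilon> by (intro add_mono[OF order_refl] mult_right_mono) auto
      also have "exp (- E * (t - s)) * (exp (- E * h) * seq_norm (B r) (w r)) = g r"
        by (simp add: g_def h_def algebra_simps flip: exp_add)
      finally show ?case by (simp add: h_def mult.commute)
    qed
  qed
  then have "exp (- E * (b - s)) * seq_norm (B b) (w b) \<le> seq_norm \<beta> (w s) + \<delta> * (b - s)"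
    by (simp add: g_def B_def)
  then have "exp (E * (b - s)) * (exp (- E * (b - s)) * seq_norm (B b) (w b))
      \<le> exp (E * (b - s)) * (seq_norm \<beta> (w s) + \<delta> * (b - s))"
    by (rule mult_left_mono) simp
  moreover have "exp (E * (b - s)) * exp (- E * (b - s)) = 1"
    by (simp flip: exp_add)
  ultimately show ?thesis by (simp only: mult.assoc[symmetric] B_def mult_1_left)
qed

text \<open>The difference of two solutions vanishes on an interval whose length \<open>\<tau>\<close> depends only on \<open>c\<close> and on the room
  between \<open>\<alpha>\<^sub>0\<close> and \<open>\<alpha>'\<close>. As the difference then vanishes at the end of this interval, the
  argument can be restarted there with the original exponent.\<close>

lemma classical_solution_unique:
  assumes \<alpha>': "\<alpha>\<^sub>0 < \<alpha>'" "\<alpha>' \<le> \<alpha>"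
    and u: "classical_solution \<alpha>\<^sub>0 \<alpha>' {0..<T} A x u"
    and v: "classical_solution \<alpha>\<^sub>0 \<alpha>' {0..<T} A x v"
    and t: "t \<in> {0..<T}"
  shows "u t = v t"
proof -
  define w where "w t n = u t n - v t n" for t n
  \<comment> \<open>The interval between the two exponents is cut in thirds: the exponent starts at the upper
    cut, where the difference is differentiable, and reaches the lower one after time \<open>\<tau>\<close>.\<close>
  define \<beta> where "\<beta> = (\<alpha>\<^sub>0 + 2 * \<alpha>') / 3"
  define \<tau> where "\<tau> = (\<alpha>' - \<alpha>\<^sub>0) / (3 * c)"
  have \<beta>: "\<alpha>\<^sub>0 < \<beta>" "\<beta> < \<alpha>'" "\<beta> \<le> \<alpha>" using \<alpha>' by (auto simp: \<beta>_def)
  have \<tau>: "0 < \<tau>" using \<alpha>' c_pos by (auto simp: \<tau>_def)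
  have spaces: "u t \<in> seq_space \<alpha>'" "v t \<in> seq_space \<alpha>'" if "t \<in> {0..<T}" for t
    using u v that by (auto simp: classical_solution_def seq_continuous_on_def)
  have w0: "w 0 = (\<lambda>n. 0)" using u v by (auto simp: w_def classical_solution_def)
  have der: "seq_has_derivative \<beta> {0..<T} w (\<lambda>n. mat_op A (w t) n + 0) t" if "t \<in> {0..<T}" for t
  proof -
    have "seq_has_derivative \<beta> {0..<T} w (\<lambda>n. mat_op A (u t) n - mat_op A (v t) n) t"
      unfolding w_def[abs_def] using u v \<beta> that
      by (intro seq_has_derivative_diff) (auto simp: classical_solution_def)
    also have "(\<lambda>n. mat_op A (u t) n - mat_op A (v t) n) = (\<lambda>n. mat_op A (w t) n + 0)"
      unfolding w_def[abs_def] using mat_op_in_space(2)[OF spaces(1)[OF that] \<beta>]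
        mat_op_in_space(2)[OF spaces(2)[OF that] \<beta>] by (simp add: mat_op_diff)
    finally show ?thesis .
  qed
  have step: "w b = (\<lambda>n. 0)" if "s \<le> b" "b \<le> s + \<tau>" "0 \<le> s" "b < T" "w s = (\<lambda>n. 0)" for s b
  proof -
    have sub: "{s..b} \<subseteq> {0..<T}" using that by auto
    have "c * (b - s) \<le> c * \<tau>" using that c_pos by (intro mult_left_mono) auto
    also have "\<dots> = (\<alpha>' - \<alpha>\<^sub>0) / 3" using c_pos by (simp add: \<tau>_def)
    also have "\<dots> < \<beta> - \<alpha>\<^sub>0" using \<alpha>' by (simp add: \<beta>_def field_simps)
    finally have low: "\<alpha>\<^sub>0 < \<beta> - c * (b - s)" by linarith
    have w: "w t \<in> seq_space \<alpha>'" if "t \<in> {s..b}" for t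
      unfolding w_def[abs_def] using that sub by (intro seq_diff(1) spaces) auto
    have "seq_norm (\<beta> - c * (b - s)) (w b) \<le> exp (E * (b - s)) * (seq_norm \<beta> (w s) + 0 * (b - s))"
    proof (rule moving_weight_estimate[OF that(1) low \<beta>(2,3) w, where f = "\<lambda>t n. 0"])
      show "seq_has_derivative \<beta> {s..b} w (\<lambda>n. mat_op A (w t) n + 0) t" if "t \<in> {s..b}" for t
        using that sub by (intro seq_has_derivative_subset[OF der sub]) auto
    qed simp_all
    then have "seq_norm (\<beta> - c * (b - s)) (w b) \<le> 0" by (simp add: that(5))
    moreover have "w b \<in> seq_space (\<beta> - c * (b - s))"
    proof (rule seq_space_mono(1)[OF w])
      have "0 \<le> c * (b - s)" using that c_pos by simp
      then show "\<beta> - c * (b - s) \<le> \<alpha>'" using \<beta> by linarith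
    qed (use that in auto)
    ultimately show ?thesis by (intro seq_norm_eq_0D)
  qed
  have "\<forall>t. 0 \<le> t \<and> t < T \<and> t \<le> real j * \<tau> \<longrightarrow> w t = (\<lambda>n. 0)" for j
  proof (induction j)
    case 0
    then show ?case using w0 by auto
  next
    case (Suc j)
    show ?case
    proof (intro allI impI)
      fix t assume t: "0 \<le> t \<and> t < T \<and> t \<le> real (Suc j) * \<tau>"
      show "w t = (\<lambda>n. 0)"
      proof (cases "t \<le> real j * \<tau>")
        case True
        then show ?thesis using Suc t by blast
      next
        case False
        have "0 \<le> real j * \<tau>" "real (Suc j) * \<tau> = real j * \<tau> + \<tau>"
          using \<tau> by (simp_all add: algebra_simps)
        with False t have le: "real j * \<tau> \<le> t" "t \<le> real j * \<tau> + \<tau>" "0 \<le> real j * \<tau>" "t < T"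
          by linarith+
        then have "w (real j * \<tau>) = (\<lambda>n. 0)" using Suc by auto
        with le show ?thesis by (rule step)
      qed
    qed
  qed
  moreover obtain j where "t \<le> real j * \<tau>"
    using reals_Archimedean3[OF \<tau>] by (metis less_imp_le)
  ultimately have "w t = (\<lambda>n. 0)" using t by auto
  then show ?thesis by (auto simp: w_def fun_eq_iff)
qed

end

section \<open>Passing to the limit in the derivative\<close>

text \<open>The mean value inequality in the sequence space, reduced to the scalar one: a partial sum of the
  norm of an increment is the increment of the complex function obtained by pairing with the
  conjugate signs of that increment.\<close>

lemma seq_mean_value:
  assumes der: "\<And>n r. r \<in> closed_segment s t \<Longrightarrow>
      ((\<lambda>r. y r n) has_vector_derivative y' r n) (at r within closed_segment s t)"
    and bd: "\<And>r. r \<in> closed_segment s t \<Longrightarrow> y' r \<in> seq_space \<gamma> \<and> seq_norm \<gamma> (y' r) \<le> K"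
  shows "(\<lambda>n. y t n - y s n) \<in> seq_space \<gamma>"
    and "seq_norm \<gamma> (\<lambda>n. y t n - y s n) \<le> K * \<bar>t - s\<bar>"
proof -
  have "(\<Sum>n<m. cmod (y t n - y s n) * exp (\<gamma> * real n)) \<le> K * \<bar>t - s\<bar>" for m
  proof -
    define \<sigma> where "\<sigma> n = cnj (sgn (y t n - y s n)) * of_real (exp (\<gamma> * real n))" for n
    define \<phi> where "\<phi> r = (\<Sum>n<m. \<sigma> n * y r n)" for r
    have \<sigma>: "cmod (\<sigma> n) \<le> exp (\<gamma> * real n)" for n
      by (simp add: \<sigma>_def norm_mult norm_sgn)
    have d\<phi>: "(\<phi> has_derivative (\<lambda>h. h *\<^sub>R (\<Sum>n<m. \<sigma> n * y' r n))) (at r within closed_segment s t)"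
      if "r \<in> closed_segment s t" for r
      unfolding \<phi>_def[abs_def] has_vector_derivative_def[symmetric]
      by (intro has_vector_derivative_sum has_vector_derivative_mult_right der that)
    have "norm (\<phi> t - \<phi> s) \<le> K * norm (t - s)"
    proof (rule differentiable_bound[OF _ d\<phi>])
      fix r assume r: "r \<in> closed_segment s t"
      have "cmod (\<Sum>n<m. \<sigma> n * y' r n) \<le> (\<Sum>n<m. cmod (y' r n) * exp (\<gamma> * real n))"
      proof (rule sum_norm_le)
        fix n
        have "cmod (\<sigma> n) * cmod (y' r n) \<le> exp (\<gamma> * real n) * cmod (y' r n)"
          by (intro mult_right_mono \<sigma>) simp
        then show "cmod (\<sigma> n * y' r n) \<le> cmod (y' r n) * exp (\<gamma> * real n)"
          by (simp only: norm_mult mult.commute[of "exp _"])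
      qed
      also have "\<dots> \<le> K"
        using bd[OF r] partial_sum_le_seq_norm order_trans by blast
      finally show "onorm (\<lambda>h. h *\<^sub>R (\<Sum>n<m. \<sigma> n * y' r n)) \<le> K"
        by (intro onorm_le) (simp add: mult.commute[of K] mult_left_mono)
    qed auto
    moreover have "\<phi> t - \<phi> s = of_real (\<Sum>n<m. cmod (y t n - y s n) * exp (\<gamma> * real n))"
    proof -
      have "\<sigma> n * (y t n - y s n) = of_real (cmod (y t n - y s n) * exp (\<gamma> * real n))" for n
      proof -
        have "cnj (sgn z) * z = of_real (cmod z)" for z :: complex
        proof (cases "z = 0")
          case False
          then show ?thesis
            by (simp add: sgn_div_norm scaleR_conv_of_real mult.commute[of "cnj z"] complex_norm_square[symmetric]
                power2_eq_square field_simps)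
        qed simp
        from this[of "y t n - y s n"] show ?thesis
          by (simp add: \<sigma>_def mult_ac)
      qed
      then show ?thesis
        by (simp add: \<phi>_def flip: sum_subtractf right_diff_distrib)
    qed
    moreover have "0 \<le> (\<Sum>n<m. cmod (y t n - y s n) * exp (\<gamma> * real n))"
      by (simp add: sum_nonneg)
    ultimately show ?thesis by (simp only: norm_of_real real_norm_def)
  qed
  from seq_space_bounded[OF this]
  show "(\<lambda>n. y t n - y s n) \<in> seq_space \<gamma>" "seq_norm \<gamma> (\<lambda>n. y t n - y s n) \<le> K * \<bar>t - s\<bar>" .
qed

text \<open>Termwise differentiation for a sequence of functions: the mean value inequality is applied to
  \<open>U N r - r V N t\<close>, whose derivative is small near \<open>t\<close>, and the resulting bound is kept
  in the limit by Fatou's lemma.\<close>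

lemma seq_has_derivative_limit:
  fixes U :: "nat \<Rightarrow> real \<Rightarrow> nat \<Rightarrow> complex"
  assumes I: "t \<in> I" "convex I"
    and U: "\<And>N n r. r \<in> I \<Longrightarrow> ((\<lambda>s. U N s n) has_vector_derivative V N r n) (at r within I)"
    and lim: "\<And>r n. r \<in> I \<Longrightarrow> (\<lambda>N. U N r n) \<longlonglongrightarrow> u r n"
    and spaces: "\<And>r. r \<in> I \<Longrightarrow> u r \<in> seq_space \<gamma>" "\<And>r. r \<in> I \<Longrightarrow> v r \<in> seq_space \<gamma>"
    and \<rho>: "0 < \<rho>" and \<kappa>: "\<kappa> \<longlonglongrightarrow> 0"
    and V: "\<And>N r. r \<in> I \<Longrightarrow> \<bar>r - t\<bar> < \<rho> \<Longrightarrow>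
        (\<lambda>n. V N r n - v r n) \<in> seq_space \<gamma> \<and> seq_norm \<gamma> (\<lambda>n. V N r n - v r n) \<le> \<kappa> N"
    and cont: "((\<lambda>r. seq_norm \<gamma> (\<lambda>n. v r n - v t n)) \<longlongrightarrow> 0) (at t within I)"
  shows "seq_has_derivative \<gamma> I u (v t) t"
proof -
  let ?Q = "\<lambda>s n. (u s n - u t n) / of_real (s - t) - v t n"
  have Q_space: "?Q s \<in> seq_space \<gamma>" if "s \<in> I" for s
    unfolding divide_inverse mult.commute[of _ "inverse _"]
    by (intro seq_diff(1) seq_scale(1) spaces that I(1))
  have Vt: "(\<lambda>N. V N t n) \<longlonglongrightarrow> v t n" for n
  proof -
    have "cmod (V N t n - v t n) \<le> \<kappa> N * exp (- (\<gamma> * real n))" for N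
    proof -
      have "cmod (V N t n - v t n) * exp (\<gamma> * real n) \<le> \<kappa> N"
        using V[OF I(1), of N] \<rho> cmod_le_seq_norm[of "\<lambda>n. V N t n - v t n" \<gamma> n] by simp
      then have "cmod (V N t n - v t n) * exp (\<gamma> * real n) * exp (- (\<gamma> * real n)) \<le> \<kappa> N * exp (- (\<gamma> * real n))"
        by (rule mult_right_mono) simp
      then show ?thesis by (simp add: mult.assoc flip: exp_add)
    qed
    then have "(\<lambda>N. V N t n - v t n) \<longlonglongrightarrow> 0"
      by (intro Lim_null_comparison[OF always_eventually tendsto_mult_left_zero[OF \<kappa>]]) blast
    then show ?thesis by (rule LIM_zero_cancel)
  qed
  have "((\<lambda>s. seq_norm \<gamma> (?Q s)) \<longlongrightarrow> 0) (at t within I)"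
  proof (rule tendstoI)
    fix e :: real assume "0 < e"
    have "\<forall>\<^sub>F r in at t within I. seq_norm \<gamma> (\<lambda>n. v r n - v t n) < e / 2"
      by (rule order_tendstoD(2)[OF cont]) (use \<open>0 < e\<close> in simp)
    then obtain \<rho>' where \<rho>': "0 < \<rho>'"
      "\<And>r. r \<in> I \<Longrightarrow> r \<noteq> t \<Longrightarrow> \<bar>r - t\<bar> < \<rho>' \<Longrightarrow> seq_norm \<gamma> (\<lambda>n. v r n - v t n) < e / 2"
      by (auto simp: eventually_at dist_real_def)
    have close: "seq_norm \<gamma> (\<lambda>n. v r n - v t n) \<le> e / 2" if "r \<in> I" "\<bar>r - t\<bar> < \<rho>'" for r
      using \<rho>'(2)[OF that(1) _ that(2)] \<open>0 < e\<close> by (cases "r = t") auto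
    have main: "seq_norm \<gamma> (?Q s) < e" if s: "s \<in> I" "s \<noteq> t" "\<bar>s - t\<bar> < min \<rho> \<rho>'" for s
    proof -
      have seg: "closed_segment t s \<subseteq> I"
        using I s by (simp add: closed_segment_subset)
      define y where "y N r n = U N r n - of_real r * V N t n" for N r n
      have y: "(\<lambda>n. y N s n - y N t n) \<in> seq_space \<gamma> \<and>
          seq_norm \<gamma> (\<lambda>n. y N s n - y N t n) \<le> (e / 2 + 2 * \<kappa> N) * \<bar>s - t\<bar>" for N
      proof -
        have der: "((\<lambda>r. y N r n) has_vector_derivative (V N r n - V N t n)) (at r within closed_segment t s)"
          if "r \<in> closed_segment t s" for n r
        proof -
          have "((\<lambda>s. U N s n) has_vector_derivative V N r n) (at r within closed_segment t s)"
            by (rule has_vector_derivative_within_subset[OF U seg]) (use that seg in auto)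
          moreover have "((\<lambda>r. of_real r * V N t n) has_vector_derivative 1 * V N t n) (at r within closed_segment t s)"
            by (intro has_vector_derivative_mult_left has_vector_derivative_of_real derivative_eq_intros) auto
          ultimately show ?thesis
            unfolding y_def by (auto intro: derivative_eq_intros)
        qed
        have bd: "(\<lambda>n. V N r n - V N t n) \<in> seq_space \<gamma> \<and> seq_norm \<gamma> (\<lambda>n. V N r n - V N t n) \<le> e / 2 + 2 * \<kappa> N"
          if "r \<in> closed_segment t s" for r
        proof -
          have r: "r \<in> I" "\<bar>r - t\<bar> < \<rho>" "\<bar>r - t\<bar> < \<rho>'"
            using that seg s by (auto simp: closed_segment_eq_real_ivl split: if_splits)
          have 1: "(\<lambda>n. V N r n - v r n) \<in> seq_space \<gamma>" "seq_norm \<gamma> (\<lambda>n. V N r n - v r n) \<le> \<kappa> N"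
            using V[OF r(1,2)] by auto
          have 2: "(\<lambda>n. V N t n - v t n) \<in> seq_space \<gamma>" "seq_norm \<gamma> (\<lambda>n. V N t n - v t n) \<le> \<kappa> N"
            using V[OF I(1)] \<rho> by auto
          note 3 = seq_diff(1)[OF spaces(2)[OF r(1)] spaces(2)[OF I(1)]]
          have eq: "(\<lambda>n. V N r n - V N t n) = (\<lambda>n. ((V N r n - v r n) + (v r n - v t n)) - (V N t n - v t n))"
            by auto
          have "seq_norm \<gamma> (\<lambda>n. V N r n - V N t n) \<le> seq_norm \<gamma> (\<lambda>n. (V N r n - v r n) + (v r n - v t n)) + \<kappa> N"
            unfolding eq using seq_diff(2)[OF seq_add(1)[OF 1(1) 3] 2(1)] 2(2) by linarith
          also have "\<dots> \<le> \<kappa> N + e / 2 + \<kappa> N"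
            using seq_add(2)[OF 1(1) 3] 1(2) close[OF r(1,3)] by linarith
          finally show ?thesis
            using seq_diff(1)[OF seq_add(1)[OF 1(1) 3] 2(1)] unfolding eq[symmetric] by simp
        qed
        show ?thesis
          using seq_mean_value[OF der bd] by simp
      qed
      have "seq_norm \<gamma> (\<lambda>n. (u s n - of_real s * v t n) - (u t n - of_real t * v t n)) \<le> (e / 2 + 2 * 0) * \<bar>s - t\<bar>"
      proof (rule seq_norm_Fatou(2))
        show "(\<lambda>N. y N s n - y N t n) \<longlonglongrightarrow> (u s n - of_real s * v t n) - (u t n - of_real t * v t n)" for n
          unfolding y_def by (intro tendsto_intros lim s I Vt)
        show "(\<lambda>N. (e / 2 + 2 * \<kappa> N) * \<bar>s - t\<bar>) \<longlonglongrightarrow> (e / 2 + 2 * 0) * \<bar>s - t\<bar>"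
          by (intro tendsto_intros \<kappa>)
      qed (use y in simp)
      also have "(\<lambda>n. (u s n - of_real s * v t n) - (u t n - of_real t * v t n)) = (\<lambda>n. of_real (s - t) * ?Q s n)"
        using s(2) by (auto simp: field_simps)
      finally have "\<bar>s - t\<bar> * seq_norm \<gamma> (?Q s) \<le> \<bar>s - t\<bar> * (e / 2)"
        unfolding seq_scale(2)[OF Q_space[OF s(1)]] norm_of_real by (simp add: mult.commute)
      then have "seq_norm \<gamma> (?Q s) \<le> e / 2"
        using s(2) by (simp add: mult_le_cancel_left)
      then show ?thesis using \<open>0 < e\<close> by linarith
    qed
    show "\<forall>\<^sub>F s in at t within I. dist (seq_norm \<gamma> (?Q s)) 0 < e"
      unfolding eventually_at
    proof (intro exI[of _ "min \<rho> \<rho>'"] conjI ballI impI)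
      show "0 < min \<rho> \<rho>'" using \<rho> \<rho>'(1) by simp
      fix s assume "s \<in> I" "s \<noteq> t \<and> dist s t < min \<rho> \<rho>'"
      then show "dist (seq_norm \<gamma> (?Q s)) 0 < e"
        using main[of s] seq_norm_nonneg[OF Q_space[of s]] by (simp add: dist_real_def)
    qed
  qed
  then show ?thesis
    using spaces I(1) by (auto simp: seq_has_derivative_def)
qed

section \<open>Truncated systems\<close>

text \<open>Truncating the three parts of the generator amounts to truncating the whole matrix, since a
  diagonal entry lies in the square \<open>n, k \<le> N\<close> exactly if \<open>n \<le> N\<close>.\<close>

lemma trunc_generator_mat:
  "generator_mat (trunc_vec N d) (trunc_mat N b) (trunc_mat N c) = trunc_mat N (generator_mat d b c)"
  by (auto simp: fun_eq_iff generator_mat_def trunc_vec_def trunc_mat_def)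

lemma mat_op_trunc_sums:
  "(\<lambda>k. trunc_mat N A n k * u k) sums (of_bool (n \<le> N) * (\<Sum>k\<le>N. A n k * u k))"
proof -
  have "(\<lambda>k. trunc_mat N A n k * u k) sums (\<Sum>k\<le>N. trunc_mat N A n k * u k)"
    by (rule sums_finite) (auto simp: trunc_mat_def)
  also have "(\<Sum>k\<le>N. trunc_mat N A n k * u k) = of_bool (n \<le> N) * (\<Sum>k\<le>N. A n k * u k)"
    by (simp add: trunc_mat_def sum_distrib_left)
  finally show ?thesis .
qed

lemma mat_op_trunc: "mat_op (trunc_mat N A) u n = of_bool (n \<le> N) * (\<Sum>k\<le>N. A n k * u k)"
  unfolding mat_op_def using mat_op_trunc_sums by (rule sums_unique[symmetric])

definition truncated_flow ::
  "nat \<Rightarrow> (nat \<Rightarrow> nat \<Rightarrow> complex) \<Rightarrow> (nat \<Rightarrow> complex) \<Rightarrow> (real \<Rightarrow> nat \<Rightarrow> complex) \<Rightarrow> bool" where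
  "truncated_flow N A x u \<longleftrightarrow>
     u 0 = x \<and> (\<forall>t. \<forall>n>N. u t n = x n) \<and>
     (\<forall>t n. ((\<lambda>s. u s n) has_vector_derivative mat_op (trunc_mat N A) (u t) n) (at t))"

text \<open>The components with index at most \<open>N\<close> form a finite linear system, solved by the power series of
  the exponential; the others are constant.\<close>

lemma truncated_flow_exists: "\<exists>u. truncated_flow N A x u"
proof -
  define y where "y j = (mat_op (trunc_mat N A) ^^ j) x" for j
  have y_Suc: "y (Suc j) n = (\<Sum>k\<le>N. A n k * y j k)" if "n \<le> N" for j n
    using that by (simp add: y_def mat_op_trunc)
  define X where "X = (\<Sum>k\<le>N. cmod (x k))"
  define L where "L = (\<Sum>n\<le>N. \<Sum>k\<le>N. cmod (A n k))"
  have "0 \<le> X" "0 \<le> L" by (auto simp: X_def L_def intro!: sum_nonneg)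
  \<comment> \<open>L is a crude bound of the finite matrix, which makes the power series converge
    everywhere.\<close>
  have y_le: "\<forall>n\<le>N. cmod (y j n) \<le> X * L ^ j" for j
  proof (induction j)
    case 0
    then show ?case
      by (auto simp: y_def X_def intro!: member_le_sum)
  next
    case (Suc j)
    show ?case
    proof (intro allI impI)
      fix n assume n: "n \<le> N"
      have "cmod (y (Suc j) n) \<le> (\<Sum>k\<le>N. cmod (A n k) * (X * L ^ j))"
        unfolding y_Suc[OF n] using Suc by (intro sum_norm_le) (auto simp: norm_mult intro!: mult_left_mono)
      also have "\<dots> = (\<Sum>k\<le>N. cmod (A n k)) * (X * L ^ j)"
        by (rule sum_distrib_right[symmetric])
      also have "\<dots> \<le> L * (X * L ^ j)"
        unfolding L_def[of] using n \<open>0 \<le> X\<close> \<open>0 \<le> L\<close>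
        by (intro mult_right_mono member_le_sum[of n "{..N}" "\<lambda>n. \<Sum>k\<le>N. cmod (A n k)"])
          (auto intro!: sum_nonneg simp: L_def[symmetric])
      finally show "cmod (y (Suc j) n) \<le> X * L ^ Suc j" by (simp add: mult_ac)
    qed
  qed
  define F where "F n z = (\<Sum>j. y j n / fact j * z ^ j)" for n z
  have sum: "summable (\<lambda>j. y j n / fact j * z ^ j)" if "n \<le> N" for n z
  proof (rule summable_comparison_test'[of _ 0])
    show "summable (\<lambda>j. X * (inverse (fact j) * (L * cmod z) ^ j))"
      by (intro summable_mult summable_exp)
    show "norm (y j n / fact j * z ^ j) \<le> X * (inverse (fact j) * (L * cmod z) ^ j)" for j
    proof -
      have "cmod (y j n) * (cmod z ^ j / fact j) \<le> X * L ^ j * (cmod z ^ j / fact j)"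
        using y_le that by (intro mult_right_mono) auto
      then show ?thesis
        by (simp add: norm_mult norm_divide norm_power power_mult_distrib field_simps)
    qed
  qed
  have dF: "(F n has_field_derivative (\<Sum>k\<le>N. A n k * F k z)) (at z)" if "n \<le> N" for n z
  proof -
    have "(F n has_field_derivative (\<Sum>j. diffs (\<lambda>j. y j n / fact j) j * z ^ j)) (at z)"
      unfolding F_def[abs_def] by (rule termdiffs_strong_converges_everywhere) (rule sum[OF that])
    also have "(\<Sum>j. diffs (\<lambda>j. y j n / fact j) j * z ^ j) = (\<Sum>j. \<Sum>k\<le>N. A n k * (y j k / fact j * z ^ j))"
    proof (rule suminf_cong)
      fix j
      have "diffs (\<lambda>j. y j n / fact j) j = y (Suc j) n / fact j"
        by (simp add: diffs_def field_simps del: of_nat_Suc)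
      then show "diffs (\<lambda>j. y j n / fact j) j * z ^ j = (\<Sum>k\<le>N. A n k * (y j k / fact j * z ^ j))"
        using that by (simp add: y_Suc sum_distrib_right sum_divide_distrib mult.assoc)
    qed
    also have "\<dots> = (\<Sum>k\<le>N. \<Sum>j. A n k * (y j k / fact j * z ^ j))"
      by (rule suminf_sum) (intro summable_mult sum, simp)
    also have "\<dots> = (\<Sum>k\<le>N. A n k * F k z)"
      unfolding F_def by (intro sum.cong refl suminf_mult sum) simp
    finally show ?thesis .
  qed
  define u where "u t n = (if n \<le> N then F n (of_real t) else x n)" for t n
  have "u 0 = x"
  proof
    fix n
    have "F n 0 = y 0 n / fact 0" unfolding F_def by (rule powser_zero)
    then show "u 0 n = x n" by (simp add: u_def y_def)
  qed
  moreover have "((\<lambda>s. u s n) has_vector_derivative mat_op (trunc_mat N A) (u t) n) (at t)" for t n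
  proof (cases "n \<le> N")
    case True
    then show ?thesis
      using has_vector_derivative_real_field[OF dF[OF True, of "of_real t"], of UNIV]
      by (simp add: u_def mat_op_trunc)
  next
    case False
    then show ?thesis by (simp add: u_def mat_op_trunc)
  qed
  ultimately have "truncated_flow N A x u"
    by (auto simp: truncated_flow_def u_def)
  then show ?thesis by blast
qed

lemma seq_finite_support:
  assumes "\<And>n. n > N \<Longrightarrow> r n = 0"
  shows "r \<in> seq_space \<gamma>" and "seq_norm \<gamma> r = (\<Sum>n\<le>N. cmod (r n) * exp (\<gamma> * real n))"
proof -
  have "(\<lambda>n. cmod (r n) * exp (\<gamma> * real n)) sums (\<Sum>n\<le>N. cmod (r n) * exp (\<gamma> * real n))"
    by (rule sums_finite) (use assms in auto)
  then show "r \<in> seq_space \<gamma>" and "seq_norm \<gamma> r = (\<Sum>n\<le>N. cmod (r n) * exp (\<gamma> * real n))"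
    by (auto simp: seq_space_def seq_norm_def sums_iff)
qed

lemma truncated_flow_in_space:
  assumes "truncated_flow N A x u" "x \<in> seq_space \<gamma>"
  shows "u t \<in> seq_space \<gamma>"
proof -
  have "(\<lambda>n. u t n - x n) \<in> seq_space \<gamma>"
    by (rule seq_finite_support(1)[of N]) (use assms in \<open>auto simp: truncated_flow_def\<close>)
  from seq_add(1)[OF this assms(2)] show ?thesis by simp
qed

text \<open>A truncated flow moves only finitely many components, so differentiability in norm, even in the
  space of the initial value, is differentiability of each component.\<close>

lemma truncated_flow_has_derivative:
  assumes u: "truncated_flow N A x u" and x: "x \<in> seq_space \<gamma>"
  shows "seq_has_derivative \<gamma> I u (mat_op (trunc_mat N A) (u t)) t"
proof -
  let ?v = "mat_op (trunc_mat N A) (u t)"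
  let ?Q = "\<lambda>s n. (u s n - u t n) / of_real (s - t) - ?v n"
  have v: "?v n = 0" if "n > N" for n using that by (simp add: mat_op_trunc)
  have Q: "?Q s n = 0" if "n > N" for s n
    using u that v[OF that] by (simp add: truncated_flow_def)
  have "((\<lambda>s. ?Q s n) \<longlongrightarrow> 0) (at t within I)" for n
  proof -
    have "((\<lambda>s. u s n) has_vector_derivative ?v n) (at t within I)"
      using u by (auto simp: truncated_flow_def intro: has_vector_derivative_at_within)
    then have "((\<lambda>s. norm (u s n - u t n - (s - t) *\<^sub>R ?v n) / norm (s - t)) \<longlongrightarrow> 0) (at t within I)"
      by (simp add: has_vector_derivative_def has_derivative_iff_norm)
    moreover have "norm (u s n - u t n - (s - t) *\<^sub>R ?v n) / norm (s - t) = norm (?Q s n)" if "s \<noteq> t" for s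
    proof -
      have "?Q s n = (u s n - u t n - (s - t) *\<^sub>R ?v n) / of_real (s - t)"
        using that by (simp add: scaleR_conv_of_real diff_divide_distrib)
      then show ?thesis by (simp only: norm_divide norm_of_real real_norm_def)
    qed
    ultimately have "((\<lambda>s. norm (?Q s n)) \<longlongrightarrow> 0) (at t within I)"
      by (elim Lim_transform_eventually) (auto simp: eventually_at_filter intro!: always_eventually)
    then show ?thesis by (rule tendsto_norm_zero_cancel)
  qed
  then have "((\<lambda>s. \<Sum>n\<le>N. cmod (?Q s n) * exp (\<gamma> * real n)) \<longlongrightarrow> (\<Sum>n\<le>N. cmod 0 * exp (\<gamma> * real n))) (at t within I)"
    by (intro tendsto_intros)
  then have "((\<lambda>s. seq_norm \<gamma> (?Q s)) \<longlongrightarrow> 0) (at t within I)"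
    using seq_finite_support(2)[OF Q] by simp
  then show ?thesis
    using truncated_flow_in_space[OF u x] seq_finite_support(1)[OF v]
    by (simp add: seq_has_derivative_def)
qed

context drift_dominated_matrix
begin

lemma trunc_drift_dominated:
  "drift_dominated_matrix (trunc_mat N A) (trunc_vec N d) \<alpha>\<^sub>0 \<alpha> E c"
proof
  show "0 \<le> trunc_vec N d n" for n by (simp add: trunc_vec_def d_nonneg)
  show "\<exists>C. \<forall>n. trunc_vec N d n \<le> C * exp (\<nu> * real n)" if \<nu>: "0 < \<nu>" for \<nu>
  proof -
    obtain C where C: "\<And>n. d n \<le> C * exp (\<nu> * real n)" using growth[OF \<nu>] by blast
    have "trunc_vec N d n \<le> C * exp (\<nu> * real n)" for n
      using C[of n] d_nonneg[of n] by (auto simp: trunc_vec_def intro: order_trans)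
    then show ?thesis by blast
  qed
  fix \<gamma> assume \<gamma>: "\<alpha>\<^sub>0 < \<gamma>" "\<gamma> \<le> \<alpha>"
  show "column_bounded \<gamma> (\<lambda>n k. trunc_mat N A n k + of_bool (n = k) * of_real (trunc_vec N d k))
        (\<lambda>k. (trunc_vec N d k + (E + c * real k)) * exp (\<gamma> * real k))"
    unfolding column_bounded_iff
  proof
    fix k
    let ?a = "\<lambda>n. trunc_mat N A n k + of_bool (n = k) * of_real (trunc_vec N d k)"
    let ?o = "\<lambda>n. A n k + of_bool (n = k) * of_real (d k)"
    show "?a \<in> seq_space \<gamma> \<and> seq_norm \<gamma> ?a \<le> (trunc_vec N d k + (E + c * real k)) * exp (\<gamma> * real k)"
    proof (cases "k \<le> N")
      case True
      have o: "?o \<in> seq_space \<gamma>" "seq_norm \<gamma> ?o \<le> (d k + (E + c * real k)) * exp (\<gamma> * real k)"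
        using columns[OF \<gamma>] by (auto simp: column_bounded_iff)
      have "cmod (?a n) * exp (\<gamma> * real n) \<le> cmod (?o n) * exp (\<gamma> * real n)" for n
        using True by (intro mult_right_mono) (auto simp: trunc_mat_def trunc_vec_def)
      from seq_dominated[OF o(1) this] o(2) True show ?thesis
        by (simp add: trunc_vec_def)
    next
      case False
      then have "?a = (\<lambda>n. 0)" by (auto simp: trunc_mat_def trunc_vec_def)
      then show ?thesis
        using False E_nonneg c_pos by (simp add: trunc_vec_def)
    qed
  qed
qed (use E_nonneg c_pos in auto)

text \<open>An entry outside the square \<open>n, k \<le> P\<close> has \<open>n + k > P\<close>, hence
  \<open>1 \<le> e\<^sup>-\<^sup>\<nu>\<^sup>P e\<^sup>\<nu>\<^sup>k e\<^sup>\<nu>\<^sup>n\<close>. The last two factors are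
  absorbed by lowering the exponent of the target and raising that of the source by \<open>\<nu>\<close>; a
  further \<open>\<nu>\<close> is the loss of the operator \<open>A\<close> itself.\<close>

lemma tail_columns:
  assumes A: "column_bounded (\<gamma> + \<nu>) A (\<lambda>k. L * exp ((\<gamma> + \<nu> + \<nu>) * real k))"
    and \<nu>: "0 \<le> \<nu>"
    and B: "\<And>n k. n \<le> P \<Longrightarrow> k \<le> P \<Longrightarrow> B n k = 0" "\<And>n k. cmod (B n k) \<le> cmod (A n k)"
  shows "column_bounded \<gamma> B (\<lambda>k. L * exp (- \<nu> * real P) * exp ((\<gamma> + 3 * \<nu>) * real k))"
  unfolding column_bounded_iff
proof
  fix k
  define z where "z = complex_of_real (exp (\<nu> * real k - \<nu> * real P))"
  have a: "(\<lambda>n. A n k) \<in> seq_space (\<gamma> + \<nu>)" "seq_norm (\<gamma> + \<nu>) (\<lambda>n. A n k) \<le> L * exp ((\<gamma> + \<nu> + \<nu>) * real k)"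
    using A by (auto simp: column_bounded_iff)
  have z: "cmod z = exp (\<nu> * real k - \<nu> * real P)" by (simp add: z_def)
  have le: "cmod (B n k) * exp (\<gamma> * real n) \<le> cmod (z * A n k) * exp ((\<gamma> + \<nu>) * real n)" for n
  proof (cases "n \<le> P \<and> k \<le> P")
    case False
    then have "P \<le> k + n" by auto
    then have "\<nu> * real P \<le> \<nu> * real (k + n)" using \<nu> by (intro mult_left_mono) auto
    then have "exp (\<gamma> * real n) \<le> exp (\<nu> * real k - \<nu> * real P) * exp ((\<gamma> + \<nu>) * real n)"
      by (simp add: algebra_simps flip: exp_add)
    then have "cmod (B n k) * exp (\<gamma> * real n) \<le> cmod (A n k) * (exp (\<nu> * real k - \<nu> * real P) * exp ((\<gamma> + \<nu>) * real n))"
      by (intro mult_mono B) auto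
    then show ?thesis by (simp add: norm_mult z mult_ac)
  qed (simp add: B)
  have "seq_norm \<gamma> (\<lambda>n. B n k) \<le> cmod z * (L * exp ((\<gamma> + \<nu> + \<nu>) * real k))"
    using seq_dominated(2)[OF seq_scale(1)[OF a(1)] le] unfolding seq_scale(2)[OF a(1)]
    by (rule order_trans) (intro mult_left_mono a, simp)
  also have "\<dots> = L * (exp (\<nu> * real k - \<nu> * real P) * exp ((\<gamma> + \<nu> + \<nu>) * real k))"
    by (simp add: z)
  also have "\<dots> = L * exp (- \<nu> * real P) * exp ((\<gamma> + 3 * \<nu>) * real k)"
    by (simp add: mult.assoc algebra_simps flip: exp_add)
  finally show "(\<lambda>n. B n k) \<in> seq_space \<gamma> \<and> seq_norm \<gamma> (\<lambda>n. B n k) \<le> L * exp (- \<nu> * real P) * exp ((\<gamma> + 3 * \<nu>) * real k)"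
    using seq_dominated(1)[OF seq_scale(1)[OF a(1)] le] by simp
qed

end

section \<open>Convergence of the truncations\<close>

definition truncation_limit :: "(nat \<Rightarrow> real \<Rightarrow> nat \<Rightarrow> complex) \<Rightarrow> real \<Rightarrow> nat \<Rightarrow> complex" where
  "truncation_limit U t n = lim (\<lambda>N. U N t n)"

lemma exp_decay_tendsto_0: "(\<lambda>N. Q * exp (- \<epsilon> * real N)) \<longlonglongrightarrow> 0" if "0 < \<epsilon>" for Q \<epsilon> :: real
  using that by real_asymp

context drift_dominated_matrix
begin

lemma truncated_flow_bound:
  assumes flow: "truncated_flow N A x u" and x: "x \<in> seq_space \<beta>'"
    and \<beta>: "\<beta> < \<beta>'" "\<beta> \<le> \<alpha>" and t: "0 \<le> t" "\<alpha>\<^sub>0 < \<beta> - c * t"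
  shows "seq_norm (\<beta> - c * t) (u t) \<le> exp (E * t) * seq_norm \<beta> x"
proof -
  have x\<beta>: "x \<in> seq_space \<beta>" using seq_space_mono(1)[OF x] \<beta> by simp
  have "seq_norm (\<beta> - c * (t - 0)) (u t) \<le> exp (E * (t - 0)) * (seq_norm \<beta> (u 0) + 0 * (t - 0))"
  proof (rule drift_dominated_matrix.moving_weight_estimate[OF trunc_drift_dominated[of N] t(1) _ \<beta>,
        where f = "\<lambda>t n. 0"])
    show "u s \<in> seq_space \<beta>'" for s by (rule truncated_flow_in_space[OF flow x])
    show "seq_has_derivative \<beta> {0..t} u (\<lambda>n. mat_op (trunc_mat N A) (u s) n + 0) s" for s
      using truncated_flow_has_derivative[OF flow x\<beta>] by simp
  qed (use t in simp_all)
  moreover have "u 0 = x" using flow by (simp add: truncated_flow_def)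
  ultimately show ?thesis by simp
qed

text \<open>The gap between \<open>\<alpha>\<close> and \<open>\<alpha>' + c T\<close> is divided into five parts \<open>\<epsilon>\<close>. One
  is given up to place the initial value in the interior of the scale, which yields the uniform
  bound \<open>R\<close> of the flows at the exponent \<open>\<alpha> - \<epsilon> - c t\<close>; three are lost in the force
  \<open>(G\<^sup>N - G\<^sup>K) u\<^sup>K\<close> by \<open>tail_columns\<close>; the last one keeps all exponents above \<open>\<alpha>'\<close>.\<close>

lemma truncated_flows_Cauchy:
  assumes \<alpha>': "\<alpha>\<^sub>0 < \<alpha>'" and T: "0 \<le> T" "\<alpha>' + c * T < \<alpha>"
    and x: "x \<in> seq_space \<alpha>" and U: "\<And>N. truncated_flow N A x (U N)"
  obtains Q \<epsilon> where "0 < \<epsilon>" "0 \<le> Q"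
    "\<And>N K t. t \<in> {0..T} \<Longrightarrow>
      seq_norm \<alpha>' (\<lambda>n. U N t n - U K t n) \<le> Q * exp (- \<epsilon> * real (min N K))"
proof -
  define \<epsilon> where "\<epsilon> = (\<alpha> - \<alpha>' - c * T) / 5"
  have \<epsilon>: "0 < \<epsilon>" "\<alpha> - c * T = \<alpha>' + 5 * \<epsilon>" using T by (auto simp: \<epsilon>_def field_simps)
  have cT: "c * t \<le> c * T" "0 \<le> c * t" if "t \<in> {0..T}" for t using that c_pos by auto
  obtain L where L: "0 \<le> L"
    "\<And>\<gamma>. \<alpha>\<^sub>0 < \<gamma> \<Longrightarrow> \<gamma> \<le> \<alpha> \<Longrightarrow> column_bounded \<gamma> A (\<lambda>k. L * exp ((\<gamma> + \<epsilon>) * real k))"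
    using operator_columns[OF \<epsilon>(1)] by blast
  define R where "R = exp (E * T) * seq_norm (\<alpha> - \<epsilon>) x"
  have x\<beta>: "x \<in> seq_space (\<alpha> - \<epsilon>)" using seq_space_mono(1)[OF x] \<epsilon> by simp
  have R0: "0 \<le> R" using seq_norm_nonneg[OF x\<beta>] by (simp add: R_def)
  have R: "seq_norm (\<alpha> - \<epsilon> - c * t) (U N t) \<le> R" if "t \<in> {0..T}" for t N
  proof -
    have "seq_norm (\<alpha> - \<epsilon> - c * t) (U N t) \<le> exp (E * t) * seq_norm (\<alpha> - \<epsilon>) x"
      by (rule truncated_flow_bound[OF U x]) (use that \<epsilon> cT[OF that] \<alpha>' in auto)
    also have "\<dots> \<le> R"
      unfolding R_def using that E_nonneg seq_norm_nonneg[OF x\<beta>]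
      by (intro mult_right_mono) (auto intro: mult_left_mono)
    finally show ?thesis .
  qed
  define Q where "Q = exp (E * T) * (L * R * T)"
  have "seq_norm \<alpha>' (\<lambda>n. U N t n - U K t n) \<le> Q * exp (- \<epsilon> * real (min N K))"
    if t: "t \<in> {0..T}" for N K t
  proof -
    define P where "P = min N K"
    define D where "D n k = trunc_mat N A n k - trunc_mat K A n k" for n k
    define w where "w t n = U N t n - U K t n" for t n
    define \<beta> where "\<beta> = \<alpha> - 4 * \<epsilon>"
    define \<delta> where "\<delta> = L * exp (- \<epsilon> * real P) * R"
    have \<beta>: "\<beta> < \<alpha>" "\<beta> \<le> \<alpha>" using \<epsilon> by (auto simp: \<beta>_def)
    have D: "column_bounded \<gamma> D (\<lambda>k. L * exp (- \<epsilon> * real P) * exp ((\<gamma> + 3 * \<epsilon>) * real k))"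
      if "\<alpha>\<^sub>0 < \<gamma>" "\<gamma> + \<epsilon> \<le> \<alpha>" for \<gamma>
    proof (rule tail_columns[OF L(2)])
      show "D n k = 0" if "n \<le> P" "k \<le> P" for n k
        using that by (simp add: D_def trunc_mat_def P_def)
      show "cmod (D n k) \<le> cmod (A n k)" for n k
        by (auto simp: D_def trunc_mat_def)
    qed (use that \<epsilon> in auto)
    have US: "U N s \<in> seq_space \<alpha>" for N s
      by (rule truncated_flow_in_space[OF U x])
    have US': "U N s \<in> seq_space \<gamma>" if "\<gamma> \<le> \<alpha>" for N s \<gamma>
      by (rule seq_space_mono(1)[OF US that])
    have low: "\<alpha>\<^sub>0 < \<beta> - c * s" "\<beta> - c * s \<le> \<beta>" "\<alpha>' \<le> \<beta> - c * s" if "s \<in> {0..T}" for s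
      using cT[OF that] \<epsilon> \<alpha>' by (auto simp: \<beta>_def)
    have "seq_norm (\<beta> - c * (t - 0)) (w t) \<le> exp (E * (t - 0)) * (seq_norm \<beta> (w 0) + \<delta> * (t - 0))"
    proof (rule drift_dominated_matrix.moving_weight_estimate[OF trunc_drift_dominated[of N] _ _ \<beta>,
          where f = "\<lambda>s. mat_op D (U K s)"])
      show "w s \<in> seq_space \<alpha>" for s
        unfolding w_def[abs_def] by (intro seq_diff(1) US)
      show "seq_has_derivative \<beta> {0..t} w (\<lambda>n. mat_op (trunc_mat N A) (w s) n + mat_op D (U K s) n) s"
        if "s \<in> {0..t}" for s
      proof -
        have "seq_has_derivative \<beta> {0..t} w (\<lambda>n. mat_op (trunc_mat N A) (U N s) n - mat_op (trunc_mat K A) (U K s) n) s"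
          unfolding w_def[abs_def]
          by (intro seq_has_derivative_diff truncated_flow_has_derivative[OF U] that
              seq_space_mono(1)[OF x] \<beta>)
        also have "(\<lambda>n. mat_op (trunc_mat N A) (U N s) n - mat_op (trunc_mat K A) (U K s) n)
            = (\<lambda>n. mat_op (trunc_mat N A) (w s) n + mat_op D (U K s) n)"
        proof
          fix n
          have "(\<lambda>k. D n k * U K s k) sums (mat_op (trunc_mat N A) (U K s) n - mat_op (trunc_mat K A) (U K s) n)"
            unfolding D_def left_diff_distrib mat_op_trunc
            by (intro sums_diff mat_op_trunc_sums)
          then have "mat_op D (U K s) n = mat_op (trunc_mat N A) (U K s) n - mat_op (trunc_mat K A) (U K s) n"
            unfolding mat_op_def[of D] by (rule sums_unique[symmetric])
          moreover have "mat_op (trunc_mat N A) (w s) n = mat_op (trunc_mat N A) (U N s) n - mat_op (trunc_mat N A) (U K s) n"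
            unfolding w_def[abs_def] by (rule mat_op_diff) (rule sums_summable[OF mat_op_trunc_sums])+
          ultimately show "mat_op (trunc_mat N A) (U N s) n - mat_op (trunc_mat K A) (U K s) n
            = mat_op (trunc_mat N A) (w s) n + mat_op D (U K s) n" by simp
        qed
        finally show ?thesis .
      qed
      show "mat_op D (U K s) \<in> seq_space \<beta>" for s
        by (rule column_bounded_operator(2)[OF D US']) (use low[of 0] T \<epsilon> in \<open>auto simp: \<beta>_def\<close>)
      show "seq_norm (\<beta> - c * (s - 0)) (mat_op D (U K s)) \<le> \<delta>" if "s \<in> {0..t}" for s
      proof -
        have s: "s \<in> {0..T}" using that t by auto
        have "column_bounded (\<beta> - c * s) D (\<lambda>k. L * exp (- \<epsilon> * real P) * exp ((\<beta> - c * s + 3 * \<epsilon>) * real k))"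
          by (rule D) (use low[OF s] \<epsilon> in \<open>auto simp: \<beta>_def\<close>)
        moreover have "U K s \<in> seq_space (\<beta> - c * s + 3 * \<epsilon>)"
          by (rule US') (use cT[OF s] \<epsilon> in \<open>auto simp: \<beta>_def\<close>)
        ultimately have "seq_norm (\<beta> - c * s) (mat_op D (U K s))
            \<le> L * exp (- \<epsilon> * real P) * seq_norm (\<beta> - c * s + 3 * \<epsilon>) (U K s)"
          by (rule column_bounded_operator(3))
        also have "\<beta> - c * s + 3 * \<epsilon> = \<alpha> - \<epsilon> - c * s" by (simp add: \<beta>_def)
        also have "L * exp (- \<epsilon> * real P) * seq_norm (\<alpha> - \<epsilon> - c * s) (U K s) \<le> \<delta>"
          unfolding \<delta>_def using L R[OF s] by (intro mult_left_mono) auto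
        finally show ?thesis by simp
      qed
    qed (use t low[OF t] in auto)
    also have "w 0 = (\<lambda>n. 0)"
      using U[of N] U[of K] by (simp add: w_def[abs_def] truncated_flow_def)
    finally have "seq_norm (\<beta> - c * t) (w t) \<le> exp (E * t) * (\<delta> * t)" by simp
    also have "\<dots> \<le> exp (E * T) * (\<delta> * T)"
      using t L R0 E_nonneg by (intro mult_mono) (auto simp: \<delta>_def intro!: mult_left_mono)
    also have "\<dots> = Q * exp (- \<epsilon> * real P)" by (simp add: Q_def \<delta>_def)
    finally have "seq_norm (\<beta> - c * t) (w t) \<le> Q * exp (- \<epsilon> * real P)" .
    moreover have "seq_norm \<alpha>' (w t) \<le> seq_norm (\<beta> - c * t) (w t)"
    proof (rule seq_space_mono(2)[OF _ low(3)[OF t]])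
      have "\<beta> - c * t \<le> \<alpha>" using \<beta>(2) low(2)[OF t] by linarith
      then show "w t \<in> seq_space (\<beta> - c * t)"
        unfolding w_def[abs_def] by (intro seq_diff(1) US')
    qed
    ultimately show ?thesis by (simp add: w_def[abs_def] P_def)
  qed
  moreover have "0 \<le> Q" using L R0 T by (simp add: Q_def)
  ultimately show thesis using that \<epsilon>(1) by blast
qed

lemma truncated_flows_converge:
  assumes \<alpha>': "\<alpha>\<^sub>0 < \<alpha>'" and T: "0 \<le> T" "\<alpha>' + c * T < \<alpha>"
    and x: "x \<in> seq_space \<alpha>" and U: "\<And>N. truncated_flow N A x (U N)"
  obtains Q \<epsilon> where "0 < \<epsilon>" "0 \<le> Q"
    "\<And>n t. t \<in> {0..T} \<Longrightarrow> (\<lambda>N. U N t n) \<longlonglongrightarrow> truncation_limit U t n"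
    "\<And>t. t \<in> {0..T} \<Longrightarrow> truncation_limit U t \<in> seq_space \<alpha>'"
    "\<And>N t. t \<in> {0..T} \<Longrightarrow> (\<lambda>n. U N t n - truncation_limit U t n) \<in> seq_space \<alpha>'"
    "\<And>N t. t \<in> {0..T} \<Longrightarrow>
      seq_norm \<alpha>' (\<lambda>n. U N t n - truncation_limit U t n) \<le> Q * exp (- \<epsilon> * real N)"
proof -
  obtain Q \<epsilon> where \<epsilon>: "0 < \<epsilon>" and Q: "0 \<le> Q"
    and Cauchy: "\<And>N K t. t \<in> {0..T} \<Longrightarrow>
      seq_norm \<alpha>' (\<lambda>n. U N t n - U K t n) \<le> Q * exp (- \<epsilon> * real (min N K))"
    by (rule truncated_flows_Cauchy[OF assms]) (rule that)
  have \<alpha>'\<alpha>: "\<alpha>' \<le> \<alpha>" using T mult_nonneg_nonneg[of c T] c_pos by linarith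
  have US: "U N t \<in> seq_space \<alpha>'" for N t
    by (rule seq_space_mono(1)[OF truncated_flow_in_space[OF U x] \<alpha>'\<alpha>])
  have lim: "(\<lambda>N. U N t n) \<longlonglongrightarrow> truncation_limit U t n" if t: "t \<in> {0..T}" for n t
  proof -
    have "Cauchy (\<lambda>N. U N t n)"
    proof (rule CauchyI)
      fix e :: real assume "0 < e"
      have "\<forall>\<^sub>F M in sequentially. Q * exp (- \<epsilon> * real M) < e * exp (\<alpha>' * real n)"
        by (rule order_tendstoD(2)[OF exp_decay_tendsto_0[OF \<epsilon>]]) (use \<open>0 < e\<close> in simp)
      then obtain M where M: "Q * exp (- \<epsilon> * real M) < e * exp (\<alpha>' * real n)"
        by (auto simp: eventually_sequentially)
      have "cmod (U N t n - U K t n) < e" if "N \<ge> M" "K \<ge> M" for N K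
      proof -
        have "cmod (U N t n - U K t n) * exp (\<alpha>' * real n) \<le> Q * exp (- \<epsilon> * real (min N K))"
          using cmod_le_seq_norm[OF seq_diff(1)[OF US US]] Cauchy[OF t] order_trans by blast
        also have "\<dots> \<le> Q * exp (- \<epsilon> * real M)"
          using that Q \<epsilon> by (intro mult_left_mono) auto
        also note M
        finally show ?thesis by simp
      qed
      then show "\<exists>M. \<forall>N\<ge>M. \<forall>K\<ge>M. norm (U N t n - U K t n) < e" by blast
    qed
    then show ?thesis
      unfolding truncation_limit_def by (simp add: Cauchy_convergent_iff convergent_LIMSEQ_iff)
  qed
  have conv: "(\<lambda>n. U N t n - truncation_limit U t n) \<in> seq_space \<alpha>' \<and>
      seq_norm \<alpha>' (\<lambda>n. U N t n - truncation_limit U t n) \<le> Q * exp (- \<epsilon> * real N)"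
    if t: "t \<in> {0..T}" for N t
  proof -
    have 1: "(\<lambda>K. U N t n - U K t n) \<longlonglongrightarrow> U N t n - truncation_limit U t n" for n
      by (intro tendsto_intros lim t)
    have 2: "\<forall>\<^sub>F K in sequentially. (\<lambda>n. U N t n - U K t n) \<in> seq_space \<alpha>' \<and>
        seq_norm \<alpha>' (\<lambda>n. U N t n - U K t n) \<le> Q * exp (- \<epsilon> * real N)"
      using eventually_ge_at_top[of N]
    proof eventually_elim
      case (elim K)
      then show ?case using seq_diff(1)[OF US US, of N t K t] Cauchy[OF t, of N K] by (simp add: min_def)
    qed
    show ?thesis
      using seq_norm_Fatou[OF 1 2 tendsto_const] by blast
  qed
  have "truncation_limit U t \<in> seq_space \<alpha>'" if t: "t \<in> {0..T}" for t
    using seq_diff(1)[OF US[of 0 t] conv[OF t, of 0, THEN conjunct1]] by simp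
  with lim conv \<epsilon> Q show thesis by (intro that[of \<epsilon> Q]) blast+
qed

lemma seq_continuous_on_mat_op:
  assumes "\<alpha>\<^sub>0 < \<gamma>" "\<gamma> < \<gamma>'" "\<gamma> \<le> \<alpha>" and u: "seq_continuous_on \<gamma>' I u"
  shows "seq_continuous_on \<gamma> I (\<lambda>t. mat_op A (u t))"
  unfolding seq_continuous_on_def
proof (intro ballI conjI)
  fix t assume t: "t \<in> I"
  have spaces: "u s \<in> seq_space \<gamma>'" if "s \<in> I" for s
    using u that by (auto simp: seq_continuous_on_def)
  show "mat_op A (u t) \<in> seq_space \<gamma>"
    by (rule mat_op_in_space(1)[OF spaces[OF t] assms(1-3)])
  obtain L where "column_bounded \<gamma> A (\<lambda>k. L * exp ((\<gamma> + (\<gamma>' - \<gamma>)) * real k))"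
    using operator_columns[of "\<gamma>' - \<gamma>"] assms by (metis diff_gt_0_iff_gt)
  then have A: "column_bounded \<gamma> A (\<lambda>k. L * exp (\<gamma>' * real k))" by simp
  let ?D = "\<lambda>s n. mat_op A (u s) n - mat_op A (u t) n"
  have D: "?D s = mat_op A (\<lambda>n. u s n - u t n)" if "s \<in> I" for s
    using mat_op_in_space(2)[OF spaces[OF that] assms(1-3)] mat_op_in_space(2)[OF spaces[OF t] assms(1-3)]
    by (simp add: fun_eq_iff mat_op_diff)
  have L: "seq_norm \<gamma> (?D s) \<le> L * seq_norm \<gamma>' (\<lambda>n. u s n - u t n)" "0 \<le> seq_norm \<gamma> (?D s)" if "s \<in> I" for s
    unfolding D[OF that]
    using column_bounded_operator(2,3)[OF A seq_diff(1)[OF spaces[OF that] spaces[OF t]]]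
    by (auto intro: seq_norm_nonneg)
  show "((\<lambda>s. seq_norm \<gamma> (?D s)) \<longlongrightarrow> 0) (at t within I)"
  proof (rule tendsto_sandwich[OF _ _ tendsto_const])
    show "((\<lambda>s. L * seq_norm \<gamma>' (\<lambda>n. u s n - u t n)) \<longlongrightarrow> 0) (at t within I)"
      using u t by (intro tendsto_mult_right_zero) (auto simp: seq_continuous_on_def)
  qed (use L in \<open>auto simp: eventually_at_filter intro!: always_eventually\<close>)
qed

text \<open>Continuous differentiability in the larger spaces is automatic, because the matrix maps a
  continuous function into a continuous function of any larger space.\<close>

lemma classical_solutionI:
  assumes "seq_continuous_on \<alpha>' I u" "u 0 = x" "\<alpha>' \<le> \<alpha>"
    and "\<And>\<gamma> t. \<alpha>\<^sub>0 < \<gamma> \<Longrightarrow> \<gamma> < \<alpha>' \<Longrightarrow> t \<in> I \<Longrightarrow> seq_has_derivative \<gamma> I u (mat_op A (u t)) t"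
  shows "classical_solution \<alpha>\<^sub>0 \<alpha>' I A x u"
  unfolding classical_solution_def seq_C1_on_def
  using assms seq_continuous_on_mat_op[OF _ _ _ assms(1)]
  by (meson less_imp_le order_trans)

lemma truncated_flow_classical_solution:
  assumes flow: "truncated_flow N A x u" and x: "x \<in> seq_space \<alpha>" and \<alpha>': "\<alpha>' \<le> \<alpha>"
  shows "classical_solution \<alpha>\<^sub>0 \<alpha>' I (trunc_mat N A) x u"
proof (rule drift_dominated_matrix.classical_solutionI[OF trunc_drift_dominated])
  have x': "x \<in> seq_space \<gamma>" if "\<gamma> \<le> \<alpha>'" for \<gamma>
    using seq_space_mono(1)[OF x] that \<alpha>' by simp
  show der: "seq_has_derivative \<gamma> I u (mat_op (trunc_mat N A) (u t)) t" if "\<gamma> < \<alpha>'" for \<gamma> t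
    using truncated_flow_has_derivative[OF flow x'] that by simp
  show "seq_continuous_on \<alpha>' I u"
    using truncated_flow_in_space[OF flow x'[OF order_refl]]
      seq_has_derivative_tendsto[OF truncated_flow_has_derivative[OF flow x'[OF order_refl]]]
    by (auto simp: seq_continuous_on_def)
  show "u 0 = x" using flow by (simp add: truncated_flow_def)
qed (rule \<alpha>')

text \<open>Every time before \<open>(\<alpha> - \<alpha>')/c\<close> lies in an interval \<open>[0, T]\<close> on which the
  truncations converge uniformly with an exponential rate. Continuity passes to the uniform limit.
  For the derivative,
  \<open>G\<^sup>N u\<^sup>N - G u = G\<^sup>N (u\<^sup>N - u) + (G\<^sup>N - G) u\<close> tends to 0 uniformly near each time, the
  second term by \<open>tail_columns\<close>.\<close>

lemma truncation_limit_classical_solution: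
  assumes \<alpha>': "\<alpha>\<^sub>0 < \<alpha>'" "\<alpha>' < \<alpha>" and x: "x \<in> seq_space \<alpha>" and U: "\<And>N. truncated_flow N A x (U N)"
  shows "classical_solution \<alpha>\<^sub>0 \<alpha>' {0..<(\<alpha> - \<alpha>') / c} A x (truncation_limit U)"
proof -
  define I where "I = {0..<(\<alpha> - \<alpha>') / c}"
  define u where "u = truncation_limit U"
  have later: "\<exists>T. 0 \<le> T \<and> \<alpha>' + c * T < \<alpha> \<and> t < T" if t: "t \<in> I" for t
  proof -
    obtain T where "t < T" "T < (\<alpha> - \<alpha>') / c" using t dense[of t "(\<alpha> - \<alpha>') / c"] by (auto simp: I_def)
    then show ?thesis using that c_pos by (intro exI[of _ T]) (auto simp: I_def field_simps)
  qed
  have US: "U N t \<in> seq_space \<alpha>'" for N t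
    by (rule seq_space_mono(1)[OF truncated_flow_in_space[OF U x]]) (use \<alpha>' in simp)
  have lim: "(\<lambda>N. U N t n) \<longlonglongrightarrow> u t n" and spaces: "u t \<in> seq_space \<alpha>'" if t: "t \<in> I" for t n
  proof -
    obtain T where T: "0 \<le> T" "\<alpha>' + c * T < \<alpha>" "t < T" using later[OF t] by blast
    have "t \<in> {0..T}" using that T by (simp add: I_def)
    then show "(\<lambda>N. U N t n) \<longlonglongrightarrow> u t n" "u t \<in> seq_space \<alpha>'"
      using truncated_flows_converge[OF \<alpha>'(1) T(1,2) x U] unfolding u_def by metis+
  qed
  have cont: "seq_continuous_on \<alpha>' I u"
    unfolding seq_continuous_on_def
  proof (intro ballI conjI spaces)
    fix t assume t: "t \<in> I"
    obtain T where T: "0 \<le> T" "\<alpha>' + c * T < \<alpha>" "t < T" using later[OF t] by blast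
    obtain Q \<epsilon> where \<epsilon>: "0 < \<epsilon>"
      and sp: "\<And>N s. s \<in> {0..T} \<Longrightarrow> (\<lambda>n. U N s n - u s n) \<in> seq_space \<alpha>'"
      and Q: "\<And>N s. s \<in> {0..T} \<Longrightarrow> seq_norm \<alpha>' (\<lambda>n. U N s n - u s n) \<le> Q * exp (- \<epsilon> * real N)"
      by (rule truncated_flows_converge[OF \<alpha>'(1) T(1,2) x U]) (rule that[unfolded u_def])
    show "((\<lambda>s. seq_norm \<alpha>' (\<lambda>n. u s n - u t n)) \<longlongrightarrow> 0) (at t within I)"
    proof (rule tendstoI)
      fix e :: real assume e: "0 < e"
      have "\<forall>\<^sub>F N in sequentially. Q * exp (- \<epsilon> * real N) < e / 3"
        by (rule order_tendstoD(2)[OF exp_decay_tendsto_0[OF \<epsilon>]]) (use e in simp)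
      then obtain N where N: "Q * exp (- \<epsilon> * real N) < e / 3"
        by (auto simp: eventually_sequentially)
      have "((\<lambda>s. seq_norm \<alpha>' (\<lambda>n. U N s n - U N t n)) \<longlongrightarrow> 0) (at t within I)"
        using seq_space_mono(1)[OF x, of \<alpha>'] \<alpha>' t
        by (intro seq_has_derivative_tendsto[OF truncated_flow_has_derivative[OF U]]) auto
      then have 1: "\<forall>\<^sub>F s in at t within I. seq_norm \<alpha>' (\<lambda>n. U N s n - U N t n) < e / 3"
        by (rule order_tendstoD(2)) (use e in simp)
      have 2: "\<forall>\<^sub>F s in at t within I. s < T"
        by (rule order_tendstoD(2)[OF tendsto_ident_at T(3)])
      have 3: "\<forall>\<^sub>F s in at t within I. s \<in> I"
        by (auto simp: eventually_at_filter)
      show "\<forall>\<^sub>F s in at t within I. dist (seq_norm \<alpha>' (\<lambda>n. u s n - u t n)) 0 < e"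
        using 1 2 3
      proof eventually_elim
        case (elim s)
        have sT: "s \<in> {0..T}" "t \<in> {0..T}" using elim t T by (auto simp: I_def)
        have eq: "(\<lambda>n. u s n - u t n) =
          (\<lambda>n. ((U N s n - U N t n) - (U N s n - u s n)) + (U N t n - u t n))" by auto
        have "seq_norm \<alpha>' (\<lambda>n. u s n - u t n) \<le> seq_norm \<alpha>' (\<lambda>n. U N s n - U N t n)
            + seq_norm \<alpha>' (\<lambda>n. U N s n - u s n) + seq_norm \<alpha>' (\<lambda>n. U N t n - u t n)"
          unfolding eq
          using seq_add(2)[OF seq_diff(1)[OF seq_diff(1)[OF US US] sp[OF sT(1)]] sp[OF sT(2)], of N s N t N N]
            seq_diff(2)[OF seq_diff(1)[OF US US] sp[OF sT(1)], of N s N t N] by linarith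
        also have "\<dots> < e"
          using elim(1) Q[OF sT(1), of N] Q[OF sT(2), of N] N by linarith
        finally show ?case
          using seq_norm_nonneg[OF seq_diff(1)[OF spaces[OF elim(3)] spaces[OF t]]] by simp
      qed
    qed
  qed
  have der: "seq_has_derivative \<gamma> I u (mat_op A (u t)) t" if \<gamma>: "\<alpha>\<^sub>0 < \<gamma>" "\<gamma> < \<alpha>'" and t: "t \<in> I" for \<gamma> t
  proof -
    obtain T where T: "0 \<le> T" "\<alpha>' + c * T < \<alpha>" "t < T" using later[OF t] by blast
    obtain Q \<epsilon> where \<epsilon>: "0 < \<epsilon>"
      and sp: "\<And>N s. s \<in> {0..T} \<Longrightarrow> (\<lambda>n. U N s n - u s n) \<in> seq_space \<alpha>'"
      and Q: "\<And>N s. s \<in> {0..T} \<Longrightarrow> seq_norm \<alpha>' (\<lambda>n. U N s n - u s n) \<le> Q * exp (- \<epsilon> * real N)"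
      by (rule truncated_flows_converge[OF \<alpha>'(1) T(1,2) x U]) (rule that[unfolded u_def])
    define \<nu> where "\<nu> = (\<alpha>' - \<gamma>) / 3"
    have \<nu>: "0 < \<nu>" "\<gamma> + 3 * \<nu> = \<alpha>'" using \<gamma> by (auto simp: \<nu>_def field_simps)
    obtain L where L: "0 \<le> L"
      "\<And>\<gamma>. \<alpha>\<^sub>0 < \<gamma> \<Longrightarrow> \<gamma> \<le> \<alpha> \<Longrightarrow> column_bounded \<gamma> A (\<lambda>k. L * exp ((\<gamma> + \<nu>) * real k))"
      using operator_columns[OF \<nu>(1)] by blast
    have B: "column_bounded \<gamma> (trunc_mat N A) (\<lambda>k. L * exp (\<alpha>' * real k))" for N
    proof (rule column_bounded_mono[OF L(2)])
      show "L * exp ((\<gamma> + \<nu>) * real k) \<le> L * exp (\<alpha>' * real k)" for k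
        using \<nu> L by (intro mult_left_mono) (auto intro!: mult_right_mono)
    qed (use \<gamma> \<alpha>' in \<open>auto simp: trunc_mat_def\<close>)
    define D where "D N n k = trunc_mat N A n k - A n k" for N n k
    have D: "column_bounded \<gamma> (D N) (\<lambda>k. L * exp (- \<nu> * real N) * exp (\<alpha>' * real k))" for N
    proof -
      have "column_bounded \<gamma> (D N) (\<lambda>k. L * exp (- \<nu> * real N) * exp ((\<gamma> + 3 * \<nu>) * real k))"
        by (rule tail_columns[OF L(2)]) (use \<gamma> \<alpha>' \<nu> in \<open>auto simp: D_def trunc_mat_def\<close>)
      then show ?thesis by (simp only: \<nu>(2))
    qed
    have "\<forall>\<^sub>F s in at t within I. seq_norm \<alpha>' (\<lambda>n. u s n - u t n) < 1 \<and> s < T"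
      using cont t T(3)
      by (intro eventually_conj order_tendstoD(2)[OF _ zero_less_one] order_tendstoD(2)[OF tendsto_ident_at])
        (auto simp: seq_continuous_on_def)
    then obtain \<rho> where \<rho>: "0 < \<rho>"
      "\<And>s. s \<in> I \<Longrightarrow> s \<noteq> t \<Longrightarrow> \<bar>s - t\<bar> < \<rho> \<Longrightarrow> seq_norm \<alpha>' (\<lambda>n. u s n - u t n) < 1 \<and> s < T"
      by (auto simp: eventually_at dist_real_def)
    have near: "seq_norm \<alpha>' (u s) \<le> seq_norm \<alpha>' (u t) + 1" "s \<in> {0..T}" if s: "s \<in> I" "\<bar>s - t\<bar> < \<rho>" for s
    proof -
      have "seq_norm \<alpha>' (\<lambda>n. u s n - u t n) \<le> 1 \<and> s < T"
        using \<rho>(2)[OF s(1) _ s(2)] T(3) by (cases "s = t") auto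
      then show "seq_norm \<alpha>' (u s) \<le> seq_norm \<alpha>' (u t) + 1" "s \<in> {0..T}"
        using seq_add(2)[OF spaces[OF t] seq_diff(1)[OF spaces[OF s(1)] spaces[OF t]]] s by (auto simp: I_def)
    qed
    define \<kappa> where "\<kappa> N = L * (Q * exp (- \<epsilon> * real N)) + L * exp (- \<nu> * real N) * (seq_norm \<alpha>' (u t) + 1)" for N
    show ?thesis
    proof (rule seq_has_derivative_limit[where U = U and V = "\<lambda>N s. mat_op (trunc_mat N A) (U N s)"
          and v = "\<lambda>s. mat_op A (u s)" and \<kappa> = \<kappa>, OF t _ _ lim])
      show "convex I" by (simp add: I_def)
      show "((\<lambda>s. U N s n) has_vector_derivative mat_op (trunc_mat N A) (U N r) n) (at r within I)" for N n r
        using U[of N] by (auto simp: truncated_flow_def intro: has_vector_derivative_at_within)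
      show "u r \<in> seq_space \<gamma>" if "r \<in> I" for r
        by (rule seq_space_mono(1)[OF spaces[OF that]]) (use \<gamma> in simp)
      have vc: "seq_continuous_on \<gamma> I (\<lambda>t. mat_op A (u t))"
        by (rule seq_continuous_on_mat_op[OF \<gamma> _ cont]) (use \<gamma> \<alpha>' in simp)
      then show "mat_op A (u r) \<in> seq_space \<gamma>" if "r \<in> I" for r
        using that by (auto simp: seq_continuous_on_def)
      show "((\<lambda>r. seq_norm \<gamma> (\<lambda>n. mat_op A (u r) n - mat_op A (u t) n)) \<longlongrightarrow> 0) (at t within I)"
        using vc t by (auto simp: seq_continuous_on_def)
      show "0 < \<rho>" by (rule \<rho>(1))
      have "(\<lambda>N. L * (Q * exp (- \<epsilon> * real N)) + L * exp (- \<nu> * real N) * (seq_norm \<alpha>' (u t) + 1))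
          \<longlonglongrightarrow> L * 0 + 0 * (seq_norm \<alpha>' (u t) + 1)"
        by (intro tendsto_intros exp_decay_tendsto_0 \<epsilon> \<nu>(1))
      then show "\<kappa> \<longlonglongrightarrow> 0" by (simp add: \<kappa>_def[abs_def])
      fix N r assume r: "r \<in> I" "\<bar>r - t\<bar> < \<rho>"
      note rT = near(2)[OF r]
      have 1: "mat_op (trunc_mat N A) (\<lambda>n. U N r n - u r n) \<in> seq_space \<gamma>"
        "seq_norm \<gamma> (mat_op (trunc_mat N A) (\<lambda>n. U N r n - u r n)) \<le> L * seq_norm \<alpha>' (\<lambda>n. U N r n - u r n)"
        using column_bounded_operator(2,3)[OF B sp[OF rT]] by blast+
      have 2: "mat_op (D N) (u r) \<in> seq_space \<gamma>"
        "seq_norm \<gamma> (mat_op (D N) (u r)) \<le> L * exp (- \<nu> * real N) * seq_norm \<alpha>' (u r)"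
        using column_bounded_operator(2,3)[OF D spaces[OF r(1)]] by blast+
      have eq: "(\<lambda>n. mat_op (trunc_mat N A) (U N r) n - mat_op A (u r) n)
          = (\<lambda>n. mat_op (trunc_mat N A) (\<lambda>n. U N r n - u r n) n + mat_op (D N) (u r) n)"
      proof
        fix n
        have sA: "summable (\<lambda>k. A n k * u r k)"
          by (rule mat_op_in_space(2)[OF spaces[OF r(1)] \<gamma>]) (use \<gamma> \<alpha>' in simp)
        have "mat_op (D N) (u r) n = mat_op (trunc_mat N A) (u r) n - mat_op A (u r) n"
          unfolding mat_op_def D_def left_diff_distrib
          by (rule suminf_diff[OF sums_summable[OF mat_op_trunc_sums] sA, symmetric])
        moreover have "mat_op (trunc_mat N A) (\<lambda>n. U N r n - u r n) n
            = mat_op (trunc_mat N A) (U N r) n - mat_op (trunc_mat N A) (u r) n"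
          by (rule mat_op_diff) (rule sums_summable[OF mat_op_trunc_sums])+
        ultimately show "mat_op (trunc_mat N A) (U N r) n - mat_op A (u r) n
          = mat_op (trunc_mat N A) (\<lambda>n. U N r n - u r n) n + mat_op (D N) (u r) n" by simp
      qed
      have "L * seq_norm \<alpha>' (\<lambda>n. U N r n - u r n) + L * exp (- \<nu> * real N) * seq_norm \<alpha>' (u r) \<le> \<kappa> N"
        unfolding \<kappa>_def using L Q[OF rT, of N] near(1)[OF r]
        by (intro add_mono mult_left_mono) auto
      then show "(\<lambda>n. mat_op (trunc_mat N A) (U N r) n - mat_op A (u r) n) \<in> seq_space \<gamma> \<and>
          seq_norm \<gamma> (\<lambda>n. mat_op (trunc_mat N A) (U N r) n - mat_op A (u r) n) \<le> \<kappa> N"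
        unfolding eq using seq_add[OF 1(1) 2(1)] 1(2) 2(2) by linarith
    qed
  qed
  have "0 \<in> I" using \<alpha>' c_pos by (simp add: I_def)
  have "u 0 = x"
  proof
    fix n
    have "(\<lambda>N. U N 0 n) = (\<lambda>N. x n)" using U by (simp add: truncated_flow_def)
    then show "u 0 n = x n" using lim[OF \<open>0 \<in> I\<close>, of n] by (simp add: LIMSEQ_const_iff)
  qed
  with cont der \<alpha>' show ?thesis
    unfolding u_def[symmetric] I_def[symmetric] by (intro classical_solutionI) auto
qed

end

section \<open>The weighted column bound\<close>

text \<open>The passage from the singular bound \<open>M(\<alpha>)/(\<alpha> - \<alpha>')\<close> to linear growth of the
  columns. For the \<open>k\<close>-th column the best exponent above \<open>\<gamma>\<close> is \<open>\<gamma> + 1/k\<close>, where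
  \<open>1/(\<alpha> - \<alpha>')\<close> becomes \<open>k\<close> and \<open>e\<^sup>(\<^sup>\<gamma>\<^sup>+\<^sup>1\<^sup>/\<^sup>k\<^sup>)\<^sup>k\<close> becomes
  \<open>e e\<^sup>\<gamma>\<^sup>k\<close>. Continuity of \<open>M\<close> at \<open>\<alpha>\<close> gives
  \<open>M(\<gamma> + 1/k) \<le> M(\<alpha> + 1/k) \<le> 2 M(\<alpha>)\<close> for all but finitely many \<open>k\<close>; the
  constant \<open>E\<close> takes care of the rest, with the exponent \<open>\<gamma> + 1\<close>.\<close>

lemma linear_column_bound:
  fixes C :: "nat \<Rightarrow> nat \<Rightarrow> complex" and M :: "real \<Rightarrow> real"
  assumes M_cont: "continuous_on {\<alpha>\<^sub>0<..} M"
    and M_incr: "mono_on {\<alpha>\<^sub>0<..} M"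
    and M_pos: "\<And>\<alpha>. \<alpha>\<^sub>0 < \<alpha> \<Longrightarrow> 0 < M \<alpha>"
    and C: "\<And>\<alpha> \<alpha>'. \<alpha>\<^sub>0 < \<alpha>' \<Longrightarrow> \<alpha>' < \<alpha> \<Longrightarrow>
      column_bounded \<alpha>' C (\<lambda>k. M \<alpha> / (\<alpha> - \<alpha>') * exp (\<alpha> * real k))"
    and \<alpha>: "\<alpha>\<^sub>0 < \<alpha>"
  obtains E where "0 \<le> E"
    "\<And>\<gamma>. \<alpha>\<^sub>0 < \<gamma> \<Longrightarrow> \<gamma> \<le> \<alpha> \<Longrightarrow>
      column_bounded \<gamma> C (\<lambda>k. (E + 2 * exp 1 * M \<alpha> * real k) * exp (\<gamma> * real k))"
proof -
  have "isCont M \<alpha>"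
    using M_cont \<alpha> by (simp add: continuous_on_eq_continuous_at)
  moreover have "(\<lambda>k. \<alpha> + inverse (real (Suc k))) \<longlonglongrightarrow> \<alpha> + 0"
    by (intro tendsto_intros LIMSEQ_inverse_real_of_nat)
  ultimately have "(\<lambda>k. M (\<alpha> + inverse (real (Suc k)))) \<longlonglongrightarrow> M \<alpha>"
    using isCont_tendsto_compose[of \<alpha> M] by simp
  moreover have "M \<alpha> < 2 * M \<alpha>" using M_pos[OF \<alpha>] by simp
  ultimately have "\<forall>\<^sub>F k in sequentially. M (\<alpha> + inverse (real (Suc k))) < 2 * M \<alpha>"
    by (rule order_tendstoD(2))
  then obtain K where K: "\<And>k. K \<le> k \<Longrightarrow> M (\<alpha> + inverse (real (Suc k))) < 2 * M \<alpha>"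
    by (auto simp: eventually_sequentially)
  define E where "E = exp (real (Suc K)) * M (\<alpha> + 1)"
  have E: "0 \<le> E" using M_pos[of "\<alpha> + 1"] \<alpha> by (simp add: E_def)
  have "column_bounded \<gamma> C (\<lambda>k. (E + 2 * exp 1 * M \<alpha> * real k) * exp (\<gamma> * real k))"
    if \<gamma>: "\<alpha>\<^sub>0 < \<gamma>" "\<gamma> \<le> \<alpha>" for \<gamma>
    unfolding column_bounded_iff
  proof (intro allI conjI)
    fix k
    have M_le: "M (\<gamma> + s) \<le> M (\<alpha> + s)" if "0 < s" for s
      using monotone_onD[OF M_incr, of "\<gamma> + s" "\<alpha> + s"] \<gamma> that by simp
    have bd: "(\<lambda>n. C n k) \<in> seq_space \<gamma>"
      "seq_norm \<gamma> (\<lambda>n. C n k) \<le> M (\<gamma> + s) / s * exp ((\<gamma> + s) * real k)" if "0 < s" for s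
      using C[OF \<gamma>(1), of "\<gamma> + s"] that by (auto simp: column_bounded_iff)
    show "(\<lambda>n. C n k) \<in> seq_space \<gamma>" using bd(1)[of 1] by simp
    show "seq_norm \<gamma> (\<lambda>n. C n k) \<le> (E + 2 * exp 1 * M \<alpha> * real k) * exp (\<gamma> * real k)"
    proof (cases "k \<le> K")
      case True
      have "seq_norm \<gamma> (\<lambda>n. C n k) \<le> M (\<gamma> + 1) * exp (real k) * exp (\<gamma> * real k)"
      proof -
        have "exp ((\<gamma> + 1) * real k) = exp (real k) * exp (\<gamma> * real k)"
          by (simp add: algebra_simps flip: exp_add)
        then show ?thesis using bd(2)[of 1] by (simp add: mult.assoc)
      qed
      also have "\<dots> \<le> M (\<alpha> + 1) * exp (real (Suc K)) * exp (\<gamma> * real k)"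
        using True M_le[of 1] M_pos[of "\<alpha> + 1"] \<alpha> by (intro mult_right_mono mult_mono) auto
      also have "\<dots> \<le> (E + 2 * exp 1 * M \<alpha> * real k) * exp (\<gamma> * real k)"
        using M_pos[OF \<alpha>] by (intro mult_right_mono) (auto simp: E_def mult.commute)
      finally show ?thesis .
    next
      case False
      then obtain j where j: "k = Suc j" "K \<le> j" by (cases k) auto
      have "seq_norm \<gamma> (\<lambda>n. C n k) \<le> M (\<gamma> + inverse (real k)) * real k * (exp 1 * exp (\<gamma> * real k))"
      proof -
        have "(\<gamma> + inverse (real k)) * real k = 1 + \<gamma> * real k"
          by (simp add: j(1) distrib_right del: of_nat_Suc)
        then have "exp ((\<gamma> + inverse (real k)) * real k) = exp 1 * exp (\<gamma> * real k)"
          by (simp only: exp_add)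
        then show ?thesis using bd(2)[of "inverse (real k)"] j(1) by (simp add: divide_inverse)
      qed
      also have "\<dots> \<le> (2 * M \<alpha>) * real k * (exp 1 * exp (\<gamma> * real k))"
        using K[OF j(2)] M_le[of "inverse (real k)"] j(1)
        by (intro mult_right_mono) (auto simp: j(1))
      also have "\<dots> = (2 * exp 1 * M \<alpha> * real k) * exp (\<gamma> * real k)" by simp
      also have "\<dots> \<le> (E + 2 * exp 1 * M \<alpha> * real k) * exp (\<gamma> * real k)"
        using E by (intro mult_right_mono) auto
      finally show ?thesis .
    qed
  qed
  with E show thesis by (rule that)
qed

section \<open>The infinite system\<close>

lemma generator_drift_dominated:
  fixes b c :: "nat \<Rightarrow> nat \<Rightarrow> complex"
  assumes d: "\<And>n. 0 \<le> d n"
    and growth: "\<And>\<nu>. 0 < \<nu> \<Longrightarrow> bdd_above (range (\<lambda>n. d n * exp (- \<nu> * real n)))"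
    and b: "\<And>\<gamma>. \<alpha>\<^sub>0 < \<gamma> \<Longrightarrow> column_bounded \<gamma> b (\<lambda>k. d k * exp (\<gamma> * real k))"
    and c: "\<And>\<gamma>. \<alpha>\<^sub>0 < \<gamma> \<Longrightarrow> \<gamma> \<le> \<alpha> \<Longrightarrow>
      column_bounded \<gamma> c (\<lambda>k. (E + v * real k) * exp (\<gamma> * real k))"
    and "0 \<le> E" "0 < v"
  shows "drift_dominated_matrix (generator_mat d b c) d \<alpha>\<^sub>0 \<alpha> E v"
proof
  show "\<exists>C. \<forall>n. d n \<le> C * exp (\<nu> * real n)" if \<nu>: "0 < \<nu>" for \<nu>
  proof -
    obtain C where C: "\<And>n. d n * exp (- \<nu> * real n) \<le> C"
      using growth[OF \<nu>] by (auto simp: bdd_above_def)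
    have "d n \<le> C * exp (\<nu> * real n)" for n
      using mult_right_mono[OF C[of n], of "exp (\<nu> * real n)"] by (simp add: mult.assoc flip: exp_add)
    then show ?thesis by blast
  qed
  fix \<gamma> assume \<gamma>: "\<alpha>\<^sub>0 < \<gamma>" "\<gamma> \<le> \<alpha>"
  show "column_bounded \<gamma> (\<lambda>n k. generator_mat d b c n k + of_bool (n = k) * of_real (d k))
        (\<lambda>k. (d k + (E + v * real k)) * exp (\<gamma> * real k))"
    by (rule column_bounded_mono[OF column_bounded_add[OF b[OF \<gamma>(1)] c[OF \<gamma>]]])
      (auto simp: generator_mat_def distrib_right)
qed (use assms in auto)

theorem theorem4p3:
  fixes a b c :: "nat \<Rightarrow> nat \<Rightarrow> complex"
    and d :: "nat \<Rightarrow> real"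
    and \<alpha>\<^sub>0 :: real
    and q M :: "real \<Rightarrow> real"
  assumes d_pos: "\<forall>n. 0 < d n"
    and E1: "\<forall>n k. a n k = generator_mat d b c n k"
    and q_range: "\<forall>\<alpha>>\<alpha>\<^sub>0. 0 < q \<alpha> \<and> q \<alpha> < 1"
    and E2: "\<forall>\<alpha>>\<alpha>\<^sub>0. \<forall>k.
        summable (\<lambda>n. cmod (b n k) * exp (\<alpha> * real n)) \<and>
        exp (- \<alpha> * real k) * (\<Sum>n. cmod (b n k) * exp (\<alpha> * real n)) \<le> q \<alpha> * d k"
    and E3: "\<forall>\<nu>>0. bdd_above (range (\<lambda>n. d n * exp (- \<nu> * real n)))"
    and M_cont: "continuous_on {\<alpha>\<^sub>0<..} M"
    and M_incr: "mono_on {\<alpha>\<^sub>0<..} M"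
    and M_pos: "\<forall>\<alpha>>\<alpha>\<^sub>0. 0 < M \<alpha>"
    and E4: "\<forall>\<alpha> \<alpha>' k. \<alpha>\<^sub>0 < \<alpha>' \<and> \<alpha>' < \<alpha> \<longrightarrow>
        summable (\<lambda>n. cmod (c n k) * exp (\<alpha>' * real n)) \<and>
        exp (- \<alpha> * real k) * (\<Sum>n. cmod (c n k) * exp (\<alpha>' * real n)) \<le> M \<alpha> / (\<alpha> - \<alpha>')"
  shows "\<forall>\<alpha>' \<alpha> x. \<alpha>\<^sub>0 < \<alpha>' \<and> \<alpha>' < \<alpha> \<and> x \<in> seq_space \<alpha> \<longrightarrow>
    (let I = {0..<existence_time M \<alpha>' \<alpha>};
         sol = (\<lambda>u. classical_solution \<alpha>\<^sub>0 \<alpha>' I a x u);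
         sol_N = (\<lambda>N u. classical_solution \<alpha>\<^sub>0 \<alpha>' I
                   (generator_mat (trunc_vec N d) (trunc_mat N b) (trunc_mat N c)) x u)
     in (\<exists>u. sol u \<and> (\<forall>v. sol v \<longrightarrow> (\<forall>t\<in>I. v t = u t))) \<and>
        (\<forall>N\<ge>1. \<exists>u. sol_N N u \<and> (\<forall>v. sol_N N v \<longrightarrow> (\<forall>t\<in>I. v t = u t))) \<and>
        (\<forall>u uN. sol u \<and> (\<forall>N\<ge>1. sol_N N (uN N)) \<longrightarrow>
           (\<forall>T. 0 < T \<and> T < existence_time M \<alpha>' \<alpha> \<longrightarrow>
              (\<lambda>N. SUP t\<in>{0..T}. \<Sum>n. ennreal (cmod (uN N t n - u t n) * exp (\<alpha>' * real n)))
                \<longlonglongrightarrow> 0)))"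
proof (intro allI impI, elim conjE)
  fix \<alpha>' \<alpha> x
  assume \<alpha>': "\<alpha>\<^sub>0 < \<alpha>'" "\<alpha>' < \<alpha>" and x: "x \<in> seq_space \<alpha>"
  define v where "v = 2 * exp 1 * M \<alpha>"
  have v: "0 < v" using M_pos \<alpha>' by (simp add: v_def)
  have b: "column_bounded \<gamma> b (\<lambda>k. d k * exp (\<gamma> * real k))" if \<gamma>: "\<alpha>\<^sub>0 < \<gamma>" for \<gamma>
    unfolding column_bounded_def
  proof (intro allI conjI)
    fix k
    show "summable (\<lambda>n. cmod (b n k) * exp (\<gamma> * real n))" using E2 \<gamma> by blast
    have "exp (- \<gamma> * real k) * (\<Sum>n. cmod (b n k) * exp (\<gamma> * real n)) \<le> q \<gamma> * d k"
      using E2 \<gamma> by blast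
    also have "\<dots> \<le> 1 * d k"
      using q_range d_pos \<gamma> by (intro mult_right_mono) (auto intro: less_imp_le)
    finally have "exp (\<gamma> * real k) * (exp (- \<gamma> * real k) * (\<Sum>n. cmod (b n k) * exp (\<gamma> * real n)))
        \<le> exp (\<gamma> * real k) * (1 * d k)"
      by (rule mult_left_mono) simp
    then show "(\<Sum>n. cmod (b n k) * exp (\<gamma> * real n)) \<le> d k * exp (\<gamma> * real k)"
      by (simp add: mult.commute flip: mult.assoc exp_add)
  qed
  have c: "column_bounded \<gamma>' c (\<lambda>k. M \<gamma> / (\<gamma> - \<gamma>') * exp (\<gamma> * real k))"
    if \<gamma>: "\<alpha>\<^sub>0 < \<gamma>'" "\<gamma>' < \<gamma>" for \<gamma> \<gamma>'
    unfolding column_bounded_def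
  proof (intro allI conjI)
    fix k
    show "summable (\<lambda>n. cmod (c n k) * exp (\<gamma>' * real n))" using E4 \<gamma> by blast
    have "exp (- \<gamma> * real k) * (\<Sum>n. cmod (c n k) * exp (\<gamma>' * real n)) \<le> M \<gamma> / (\<gamma> - \<gamma>')"
      using E4 \<gamma> by blast
    then have "exp (\<gamma> * real k) * (exp (- \<gamma> * real k) * (\<Sum>n. cmod (c n k) * exp (\<gamma>' * real n)))
        \<le> exp (\<gamma> * real k) * (M \<gamma> / (\<gamma> - \<gamma>'))"
      by (rule mult_left_mono) simp
    then show "(\<Sum>n. cmod (c n k) * exp (\<gamma>' * real n)) \<le> M \<gamma> / (\<gamma> - \<gamma>') * exp (\<gamma> * real k)"
      by (simp add: mult.commute flip: mult.assoc exp_add)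
  qed
  have "\<alpha>\<^sub>0 < \<alpha>" using \<alpha>' by simp
  obtain E where E: "0 \<le> E" "\<And>\<gamma>. \<alpha>\<^sub>0 < \<gamma> \<Longrightarrow> \<gamma> \<le> \<alpha> \<Longrightarrow>
      column_bounded \<gamma> c (\<lambda>k. (E + v * real k) * exp (\<gamma> * real k))"
    by (rule linear_column_bound[OF M_cont M_incr M_pos[rule_format] c \<open>\<alpha>\<^sub>0 < \<alpha>\<close>],
        assumption, assumption, assumption, rule that[unfolded v_def])
  have a: "a = generator_mat d b c" using E1 by (simp add: fun_eq_iff)
  interpret drift_dominated_matrix a d \<alpha>\<^sub>0 \<alpha> E v
    unfolding a using d_pos E3 by (intro generator_drift_dominated b E v) (auto intro: less_imp_le)
  have time: "existence_time M \<alpha>' \<alpha> = (\<alpha> - \<alpha>') / v"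
    by (simp add: existence_time_def v_def)
  have aN: "generator_mat (trunc_vec N d) (trunc_mat N b) (trunc_mat N c) = trunc_mat N a" for N
    by (simp add: trunc_generator_mat a)
  define I where "I = {0..<(\<alpha> - \<alpha>') / v}"
  define sol where "sol H u \<longleftrightarrow> classical_solution \<alpha>\<^sub>0 \<alpha>' I H x u" for H u
  have "\<exists>U. \<forall>N. truncated_flow N a x (U N)"
    by (intro choice allI truncated_flow_exists)
  then obtain U where U: "\<And>N. truncated_flow N a x (U N)" by blast
  define u\<^sub>0 where "u\<^sub>0 = truncation_limit U"
  have sol: "sol a u\<^sub>0"
    unfolding sol_def I_def u\<^sub>0_def by (rule truncation_limit_classical_solution[OF \<alpha>' x U])
  have solN: "sol (trunc_mat N a) (U N)" for N
    unfolding sol_def by (rule truncated_flow_classical_solution[OF U x]) (use \<alpha>' in simp)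
  have unique: "w t = u\<^sub>0 t" if "sol a w" "t \<in> I" for w t
    using classical_solution_unique[OF \<alpha>'(1) _ that(1)[unfolded sol_def I_def] sol[unfolded sol_def I_def]] that(2) \<alpha>'
    by (simp add: I_def)
  have uniqueN: "w t = U N t" if "sol (trunc_mat N a) w" "t \<in> I" for N w t
    using drift_dominated_matrix.classical_solution_unique[OF trunc_drift_dominated \<alpha>'(1) _
        that(1)[unfolded sol_def I_def] solN[unfolded sol_def I_def]] that(2) \<alpha>'
    by (simp add: I_def)
  have conv: "(\<lambda>N. SUP t\<in>{0..T}. \<Sum>n. ennreal (cmod (uN N t n - u t n) * exp (\<alpha>' * real n))) \<longlonglongrightarrow> 0"
    if u: "sol a u" and uN: "\<forall>N\<ge>1. sol (trunc_mat N a) (uN N)" and T: "0 < T" "T < (\<alpha> - \<alpha>') / v" for u uN T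
  proof -
    have T': "0 \<le> T" "\<alpha>' + v * T < \<alpha>" using T v by (auto simp: field_simps)
    obtain Q \<epsilon> where \<epsilon>: "0 < \<epsilon>"
      and sp: "\<And>N s. s \<in> {0..T} \<Longrightarrow> (\<lambda>n. U N s n - u\<^sub>0 s n) \<in> seq_space \<alpha>'"
      and Q: "\<And>N s. s \<in> {0..T} \<Longrightarrow> seq_norm \<alpha>' (\<lambda>n. U N s n - u\<^sub>0 s n) \<le> Q * exp (- \<epsilon> * real N)"
      by (rule truncated_flows_converge[OF \<alpha>'(1) T' x U]) (rule that[unfolded u\<^sub>0_def])
    have le: "(SUP t\<in>{0..T}. \<Sum>n. ennreal (cmod (uN N t n - u t n) * exp (\<alpha>' * real n))) \<le> ennreal (Q * exp (- \<epsilon> * real N))"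
      if N: "1 \<le> N" for N
    proof (rule SUP_least)
      fix t assume t: "t \<in> {0..T}"
      then have tI: "t \<in> I" using T by (auto simp: I_def)
      have "(\<Sum>n. ennreal (cmod (uN N t n - u t n) * exp (\<alpha>' * real n)))
          = (\<Sum>n. ennreal (cmod (U N t n - u\<^sub>0 t n) * exp (\<alpha>' * real n)))"
        using unique[OF u tI] uniqueN[OF uN[rule_format, OF N] tI] by simp
      also have "\<dots> = ennreal (seq_norm \<alpha>' (\<lambda>n. U N t n - u\<^sub>0 t n))"
        unfolding seq_norm_def using sp[OF t, of N] by (intro suminf_ennreal2) (auto simp: seq_space_def)
      also have "\<dots> \<le> ennreal (Q * exp (- \<epsilon> * real N))"
        by (rule ennreal_leI[OF Q[OF t]])
      finally show "(\<Sum>n. ennreal (cmod (uN N t n - u t n) * exp (\<alpha>' * real n))) \<le> ennreal (Q * exp (- \<epsilon> * real N))" .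
    qed
    have "(\<lambda>N. ennreal (Q * exp (- \<epsilon> * real N))) \<longlonglongrightarrow> ennreal 0"
      by (intro tendsto_ennrealI exp_decay_tendsto_0 \<epsilon>)
    then have lim: "(\<lambda>N. ennreal (Q * exp (- \<epsilon> * real N))) \<longlonglongrightarrow> 0" by simp
    show ?thesis
      by (rule tendsto_sandwich[OF _ eventually_sequentiallyI[of 1, OF le] tendsto_const lim]) simp_all
  qed
  show "let I = {0..<existence_time M \<alpha>' \<alpha>};
         sol = (\<lambda>u. classical_solution \<alpha>\<^sub>0 \<alpha>' I a x u);
         sol_N = (\<lambda>N u. classical_solution \<alpha>\<^sub>0 \<alpha>' I
                   (generator_mat (trunc_vec N d) (trunc_mat N b) (trunc_mat N c)) x u)
     in (\<exists>u. sol u \<and> (\<forall>v. sol v \<longrightarrow> (\<forall>t\<in>I. v t = u t))) \<and>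
        (\<forall>N\<ge>1. \<exists>u. sol_N N u \<and> (\<forall>v. sol_N N v \<longrightarrow> (\<forall>t\<in>I. v t = u t))) \<and>
        (\<forall>u uN. sol u \<and> (\<forall>N\<ge>1. sol_N N (uN N)) \<longrightarrow>
           (\<forall>T. 0 < T \<and> T < existence_time M \<alpha>' \<alpha> \<longrightarrow>
              (\<lambda>N. SUP t\<in>{0..T}. \<Sum>n. ennreal (cmod (uN N t n - u t n) * exp (\<alpha>' * real n)))
                \<longlonglongrightarrow> 0))"
    unfolding Let_def aN time I_def[symmetric] sol_def[symmetric]
  proof (intro conjI allI impI)
    show "\<exists>u. sol a u \<and> (\<forall>v. sol a v \<longrightarrow> (\<forall>t\<in>I. v t = u t))"
      using sol unique by blast
    show "\<exists>u. sol (trunc_mat N a) u \<and> (\<forall>v. sol (trunc_mat N a) v \<longrightarrow> (\<forall>t\<in>I. v t = u t))" for N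
      using solN uniqueN by blast
  qed (use conv in blast)
qed

end
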